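(* Let $g(z)=\sum_{n=0}^{\infty} b_n z^n$ be analytic in the unit disc $\mathbb{D}$. Let $0<\alpha<2$ and $\beta\in\mathbb{R}$. Then the following conditions are equivalent: (1) The operator $\mathcal{H}_g:\mathcal{D}^2_\alpha\to\mathcal{D}^2_\beta$ is compact. (2) $\displaystyle\sum_{n=2^N}^{2^{N+1}-1}|b_{n+1}|^2=o\left(2^{N(\beta-\alpha-1)}\right)$ as $N\to\infty$.
   Context: $\mathbb{D}$ is the open unit disc of $\mathbb{C}$ and $H(\mathbb{D})$ is the space of all analytic functions in $\mathbb{D}$. For $g\in H(\mathbb{D})$ the generalized Hilbert operator is $\mathcal{H}_g(f)(z)=\int_0^1 f(t)g'(tz)\,dt$, $z\in\mathbb{D}$, for $f\in H(\mathbb{D})$ with $\int_0^1|f(t)|\,dt<\infty$ (this holds for every $f\in\mathcal{D}^2_\alpha$ when $\alpha<2$). For $\gamma\in\mathbb{R}$, $\mathcal{D}^2_\gamma$ is the space of $h(z)=\sum_{n\ge0}c_nz^n\in H(\mathbb{D})$ with $\|h\|^2_{\mathcal{D}^2_\gamma}=|c_0|^2+\sum_{n=1}^\infty n^{1-\gamma}|c_n|^2<\infty$. *)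

theory Defs
  imports "HOL-Complex_Analysis.Complex_Analysis" "HOL-Library.Landau_Symbols"
begin

text \<open>
  An analytic function on the unit disc is represented by the function on \<open>complex\<close> that agrees with
  it on the disc and vanishes outside, so that distinct elements of the spaces below are distinct
  as analytic functions on the disc.  The sequence \<open>fps_nth (fps_expansion h 0)\<close> is the sequence of
  Taylor coefficients of \<open>h\<close> at 0.
\<close>

definition D2_norm :: "real \<Rightarrow> (complex \<Rightarrow> complex) \<Rightarrow> real" where
  "D2_norm \<gamma> h = sqrt ((cmod (fps_nth (fps_expansion h 0) 0))\<^sup>2 +
     (\<Sum>n. real (Suc n) powr (1 - \<gamma>) * (cmod (fps_nth (fps_expansion h 0) (Suc n)))\<^sup>2))"

definition D2 :: "real \<Rightarrow> (complex \<Rightarrow> complex) set" where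
  "D2 \<gamma> = {h. h holomorphic_on ball 0 1 \<and> (\<forall>z. z \<notin> ball 0 1 \<longrightarrow> h z = 0) \<and>
     summable (\<lambda>n. real (Suc n) powr (1 - \<gamma>) * (cmod (fps_nth (fps_expansion h 0) (Suc n)))\<^sup>2)}"

text \<open>
  The locale \<^locale>\<open>Metric_space\<close> asks for nonnegativity and symmetry of the distance also off the
  carrier; this is the only reason for the case distinction.
\<close>

definition D2_dist :: "real \<Rightarrow> (complex \<Rightarrow> complex) \<Rightarrow> (complex \<Rightarrow> complex) \<Rightarrow> real" where
  "D2_dist \<gamma> f h = (if f \<in> D2 \<gamma> \<and> h \<in> D2 \<gamma> then D2_norm \<gamma> (\<lambda>z. f z - h z) else 0)"

definition gen_hilbert :: "(complex \<Rightarrow> complex) \<Rightarrow> (complex \<Rightarrow> complex) \<Rightarrow> complex \<Rightarrow> complex" where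
  "gen_hilbert g f z =
     (if z \<in> ball 0 1
      then (LINT t:{0..<1}|lborel. f (complex_of_real t) * deriv g (complex_of_real t * z))
      else 0)"

text \<open>
  Compactness of a linear operator between normed spaces, given by their carriers and norm
  distances: bounded sets are mapped to relatively compact sets.
\<close>

definition compact_operator ::
  "'a set \<Rightarrow> ('a \<Rightarrow> 'a \<Rightarrow> real) \<Rightarrow> 'b set \<Rightarrow> ('b \<Rightarrow> 'b \<Rightarrow> real) \<Rightarrow> ('a \<Rightarrow> 'b) \<Rightarrow> bool" where
  "compact_operator M1 d1 M2 d2 T \<longleftrightarrow> T \<in> M1 \<rightarrow> M2 \<and>
     (\<forall>S. Metric_space.mbounded M1 d1 S \<longrightarrow>
        compactin (Metric_space.mtopology M2 d2) (Metric_space.mtopology M2 d2 closure_of (T ` S)))"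


lemma D2_coeff_diff:
  assumes "f \<in> D2 \<gamma>" "h \<in> D2 \<gamma>"
  shows "fps_nth (fps_expansion (\<lambda>z. f z - h z) 0) n =
         fps_nth (fps_expansion f 0) n - fps_nth (fps_expansion h 0) n"
proof -
  have "(deriv ^^ n) (\<lambda>w. f w - h w) 0 = (deriv ^^ n) f 0 - (deriv ^^ n) h 0"
    by (rule higher_deriv_diff[of _ "ball 0 1"]) (use assms in \<open>auto simp: D2_def\<close>)
  thus ?thesis by (simp add: fps_expansion_def diff_divide_distrib)
qed

lemma sqrt_suminf_triangle:
  fixes a b :: "nat \<Rightarrow> real"
  assumes a: "summable (\<lambda>n. (a n)\<^sup>2)" and b: "summable (\<lambda>n. (b n)\<^sup>2)"
  shows "summable (\<lambda>n. (a n + b n)\<^sup>2)"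
    and "sqrt (\<Sum>n. (a n + b n)\<^sup>2) \<le> sqrt (\<Sum>n. (a n)\<^sup>2) + sqrt (\<Sum>n. (b n)\<^sup>2)"
proof -
  show s: "summable (\<lambda>n. (a n + b n)\<^sup>2)"
  proof (rule summable_comparison_test')
    show "summable (\<lambda>n. 2 * (a n)\<^sup>2 + 2 * (b n)\<^sup>2)"
      by (intro summable_add summable_mult a b)
    show "norm ((a n + b n)\<^sup>2) \<le> 2 * (a n)\<^sup>2 + 2 * (b n)\<^sup>2" if "n \<ge> 0" for n
      unfolding real_norm_def abs_power2 unfolding power2_sum
      using sum_squares_bound[of "a n" "b n"] by linarith
  qed
  have "(\<lambda>n. sqrt (\<Sum>i<n. (a i + b i)\<^sup>2)) \<longlonglongrightarrow> sqrt (\<Sum>n. (a n + b n)\<^sup>2)"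
    by (intro tendsto_real_sqrt summable_LIMSEQ s)
  moreover have "(\<lambda>n. sqrt (\<Sum>i<n. (a i)\<^sup>2) + sqrt (\<Sum>i<n. (b i)\<^sup>2))
                   \<longlonglongrightarrow> sqrt (\<Sum>n. (a n)\<^sup>2) + sqrt (\<Sum>n. (b n)\<^sup>2)"
    by (intro tendsto_intros summable_LIMSEQ a b)
  moreover have "sqrt (\<Sum>i<n. (a i + b i)\<^sup>2) \<le> sqrt (\<Sum>i<n. (a i)\<^sup>2) + sqrt (\<Sum>i<n. (b i)\<^sup>2)" for n
    using L2_set_triangle_ineq[of a b "{..<n}"] by (simp add: L2_set_def)
  ultimately show "sqrt (\<Sum>n. (a n + b n)\<^sup>2) \<le> sqrt (\<Sum>n. (a n)\<^sup>2) + sqrt (\<Sum>n. (b n)\<^sup>2)"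
    by (intro LIMSEQ_le) auto
qed

definition D2_seq :: "real \<Rightarrow> (complex \<Rightarrow> complex) \<Rightarrow> nat \<Rightarrow> real" where
  "D2_seq \<gamma> h n = (if n = 0 then 1 else sqrt (real n powr (1 - \<gamma>))) *
     cmod (fps_nth (fps_expansion h 0) n)"

lemma D2_seq_Suc:
  "(D2_seq \<gamma> h (Suc n))\<^sup>2 =
     real (Suc n) powr (1 - \<gamma>) * (cmod (fps_nth (fps_expansion h 0) (Suc n)))\<^sup>2"
  by (simp add: D2_seq_def power_mult_distrib del: of_nat_Suc)

lemma D2_iff_seq:
  "h \<in> D2 \<gamma> \<longleftrightarrow> h holomorphic_on ball 0 1 \<and> (\<forall>z. z \<notin> ball 0 1 \<longrightarrow> h z = 0) \<and>
     summable (\<lambda>n. (D2_seq \<gamma> h n)\<^sup>2)"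
  unfolding D2_def by (subst summable_Suc_iff[symmetric]) (simp add: D2_seq_Suc del: of_nat_Suc)

lemma D2_norm_seq:
  assumes "summable (\<lambda>n. (D2_seq \<gamma> h n)\<^sup>2)"
  shows "D2_norm \<gamma> h = sqrt (\<Sum>n. (D2_seq \<gamma> h n)\<^sup>2)"
proof -
  have "(D2_seq \<gamma> h 0)\<^sup>2 = (cmod (fps_nth (fps_expansion h 0) 0))\<^sup>2"
    by (simp add: D2_seq_def)
  thus ?thesis
    unfolding D2_norm_def suminf_split_head[OF assms, unfolded D2_seq_Suc, THEN eq_diff_eq[THEN iffD1], symmetric]
    by (simp add: add.commute)
qed

lemma D2_diff:
  assumes f: "f \<in> D2 \<gamma>" and h: "h \<in> D2 \<gamma>"
  shows "(\<lambda>z. f z - h z) \<in> D2 \<gamma>"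
proof -
  have le: "D2_seq \<gamma> (\<lambda>z. f z - h z) n \<le> D2_seq \<gamma> f n + D2_seq \<gamma> h n" for n
    unfolding D2_seq_def D2_coeff_diff[OF f h] distrib_left[symmetric]
    by (intro mult_left_mono norm_triangle_ineq4) auto
  have "summable (\<lambda>n. (D2_seq \<gamma> f n + D2_seq \<gamma> h n)\<^sup>2)"
    using f h by (intro sqrt_suminf_triangle) (auto simp: D2_iff_seq)
  hence "summable (\<lambda>n. (D2_seq \<gamma> (\<lambda>z. f z - h z) n)\<^sup>2)"
    by (rule summable_comparison_test'[where N = 0])
       (use le in \<open>auto intro!: power_mono simp: D2_seq_def\<close>)
  thus ?thesis using f h by (auto simp: D2_iff_seq intro!: holomorphic_intros)
qed

lemma D2_norm_eq_0:
  assumes h: "h \<in> D2 \<gamma>" and 0: "D2_norm \<gamma> h = 0"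
  shows "h z = 0"
proof (cases "z \<in> ball 0 1")
  case True
  have s: "summable (\<lambda>n. (D2_seq \<gamma> h n)\<^sup>2)" using h by (simp add: D2_iff_seq)
  have "\<forall>n. (D2_seq \<gamma> h n)\<^sup>2 = 0"
    using 0 suminf_eq_zero_iff[OF s] by (simp add: D2_norm_seq[OF s])
  hence "fps_nth (fps_expansion h 0) n = 0" for n
    by (auto simp: D2_seq_def split: if_splits dest: spec[of _ n])
  hence "(deriv ^^ n) h 0 / fact n = 0" for n by (simp add: fps_expansion_def)
  moreover have "(\<lambda>n. (deriv ^^ n) h 0 / fact n * (z - 0) ^ n) sums h z"
    by (rule holomorphic_power_series[of h 0 1]) (use h True in \<open>auto simp: D2_def\<close>)
  ultimately have "(\<lambda>n. 0) sums h z" by simp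
  thus ?thesis using sums_unique2 sums_zero by blast
qed (use h in \<open>auto simp: D2_def\<close>)

lemma Metric_space_D2: "Metric_space (D2 \<gamma>) (D2_dist \<gamma>)"
proof
  have sm: "summable (\<lambda>n. (D2_seq \<gamma> h n)\<^sup>2)" if "h \<in> D2 \<gamma>" for h
    using that by (simp add: D2_iff_seq)
  have nrm: "D2_dist \<gamma> f h = sqrt (\<Sum>n. (D2_seq \<gamma> (\<lambda>z. f z - h z) n)\<^sup>2)"
    if "f \<in> D2 \<gamma>" "h \<in> D2 \<gamma>" for f h
    using that D2_norm_seq[OF sm[OF D2_diff[OF that]]] by (simp add: D2_dist_def)
  have coeff: "D2_seq \<gamma> (\<lambda>z. f z - h z) n = (if n = 0 then 1 else sqrt (real n powr (1 - \<gamma>))) *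
     cmod (fps_nth (fps_expansion f 0) n - fps_nth (fps_expansion h 0) n)"
    if "f \<in> D2 \<gamma>" "h \<in> D2 \<gamma>" for f h n
    using D2_coeff_diff[OF that] by (simp add: D2_seq_def)
  show "0 \<le> D2_dist \<gamma> f h" for f h
  proof (cases "f \<in> D2 \<gamma> \<and> h \<in> D2 \<gamma>")
    case True
    thus ?thesis using sm[OF D2_diff] by (auto simp: nrm intro!: suminf_nonneg)
  qed (auto simp: D2_dist_def)
  show "D2_dist \<gamma> f h = D2_dist \<gamma> h f" for f h
  proof (cases "f \<in> D2 \<gamma> \<and> h \<in> D2 \<gamma>")
    case True
    thus ?thesis by (simp add: nrm coeff norm_minus_commute)
  qed (auto simp: D2_dist_def)
  show "D2_dist \<gamma> f h = 0 \<longleftrightarrow> f = h" if fh: "f \<in> D2 \<gamma>" "h \<in> D2 \<gamma>" for f h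
  proof
    assume "D2_dist \<gamma> f h = 0"
    hence "D2_norm \<gamma> (\<lambda>z. f z - h z) = 0" using fh by (simp add: D2_dist_def)
    from D2_norm_eq_0[OF D2_diff[OF fh] this] show "f = h" by auto
  next
    assume "f = h"
    hence "D2_seq \<gamma> (\<lambda>z. f z - h z) n = 0" for n
      by (subst coeff[OF fh]) simp
    thus "D2_dist \<gamma> f h = 0" by (simp add: nrm[OF fh])
  qed
  show "D2_dist \<gamma> f k \<le> D2_dist \<gamma> f h + D2_dist \<gamma> h k"
    if m: "f \<in> D2 \<gamma>" "h \<in> D2 \<gamma>" "k \<in> D2 \<gamma>" for f h k
  proof -
    note t = sqrt_suminf_triangle[OF sm[OF D2_diff[OF m(1,2)]] sm[OF D2_diff[OF m(2,3)]]]
    have le: "D2_seq \<gamma> (\<lambda>z. f z - k z) n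
          \<le> D2_seq \<gamma> (\<lambda>z. f z - h z) n + D2_seq \<gamma> (\<lambda>z. h z - k z) n" for n
      unfolding coeff[OF m(1,3)] coeff[OF m(1,2)] coeff[OF m(2,3)] distrib_left[symmetric]
      by (intro mult_left_mono norm_diff_triangle_le[OF order_refl order_refl]) auto
    have "(\<Sum>n. (D2_seq \<gamma> (\<lambda>z. f z - k z) n)\<^sup>2)
       \<le> (\<Sum>n. (D2_seq \<gamma> (\<lambda>z. f z - h z) n + D2_seq \<gamma> (\<lambda>z. h z - k z) n)\<^sup>2)"
      using le by (intro suminf_le power_mono sm D2_diff m t(1)) (auto simp: D2_seq_def)
    thus ?thesis using t(2) by (simp add: nrm m order_trans[OF real_sqrt_le_mono])
  qed
qed

end

theory Submission
  imports Defs
begin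

text \<open>
  If \<open>a k\<close> are the Taylor coefficients of \<open>f\<close>, those of \<open>gen_hilbert g f\<close> are
  \<open>(n + 1) * b (n + 1) * m n\<close> with the moments \<open>m n = (\<Sum>k. a k / (n + k + 1))\<close>. Since
  \<open>\<bar>m n\<bar>\<close> is dominated by the decreasing sequence \<open>M n = (\<Sum>k. \<bar>a k\<bar> / (n + k + 1))\<close>, on a dyadic
  block only \<open>M (2 ^ N)\<close> and the block sum of \<open>\<bar>b (n + 1)\<bar>\<^sup>2\<close> matter, and a weighted dyadic
  Hilbert inequality bounds \<open>\<Sum>N. 2 powr (N * (2 - \<alpha>)) * (M (2 ^ N))\<^sup>2\<close> by the squared norm of
  \<open>f\<close>. A bounded subset of \<open>D2 \<beta>\<close> is totally bounded iff the tails of its norm series are uniformly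
  small. Hence the little-o condition makes the image of a bounded set totally bounded; conversely,
  for normalized test functions with coefficients supported on the \<open>N\<close>-th block, the uniform
  smallness of the tails of the images is the little-o condition.
\<close>

section \<open>A dyadic Hilbert inequality\<close>

text \<open>The mean value theorem on [n, n+1]; it takes the place of comparing sums with integrals
  in the next two estimates.\<close>

lemma powr_Suc_diff:
  fixes p :: real
  assumes "n > 0"
  obtains z where "real n < z" "z < real (Suc n)"
    "real (Suc n) powr p - real n powr p = p * z powr (p - 1)"
proof -
  have "\<exists>z>real n. z < real (Suc n) \<and> real (Suc n) powr p - real n powr p =
          (real (Suc n) - real n) * (p * z powr (p - 1))"
    by (rule MVT2) (use assms in \<open>auto intro!: derivative_eq_intros simp: powr_diff\<close>)
  thus ?thesis using that by auto
qed

text \<open>Since \<open>x powr - s\<close> decreases, each summand is at most the increment of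
  \<open>x powr (1 - s) / (1 - s)\<close> over its unit interval, and the increments
  telescope.\<close>

lemma sum_powr_le:
  fixes s :: real
  assumes "0 < s" "s < 1"
  shows "(\<Sum>k<n. real (Suc k) powr - s) \<le> real n powr (1 - s) / (1 - s)"
proof (induction n)
  case (Suc n)
  have "(1 - s) * real (Suc n) powr - s \<le> real (Suc n) powr (1 - s) - real n powr (1 - s)"
  proof (cases "n = 0")
    case False
    then obtain z where z: "real n < z" "z < real (Suc n)"
      "real (Suc n) powr (1 - s) - real n powr (1 - s) = (1 - s) * z powr (1 - s - 1)"
      using powr_Suc_diff[of n "1 - s"] by auto
    have "real (Suc n) powr - s \<le> z powr - s"
      using z assms by (intro powr_mono2') auto
    thus ?thesis using z assms by simp
  qed (use assms in auto)
  hence "real (Suc n) powr - s \<le> (real (Suc n) powr (1 - s) - real n powr (1 - s)) / (1 - s)"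
    using assms by (simp add: field_simps)
  thus ?case using Suc by (simp add: diff_divide_distrib)
qed simp

text \<open>Telescoping against \<open>- (x powr - s) / s\<close>. The bound does not depend on
  \<open>K\<close>, so it controls the infinite tail.\<close>

lemma sum_powr_tail_le:
  fixes s :: real
  assumes "0 < s" "m > 0"
  shows "(\<Sum>k=m..<K. real (Suc k) powr (- s - 1)) \<le> real m powr - s / s"
proof -
  have "(\<Sum>k=m..<K. real (Suc k) powr (- s - 1)) \<le> (real m powr - s - real K powr - s) / s"
    if "m \<le> K" using that
  proof (induction K rule: dec_induct)
    case (step K)
    hence "K > 0" using assms by simp
    then obtain z where z: "real K < z" "z < real (Suc K)"
      "real (Suc K) powr - s - real K powr - s = - s * z powr (- s - 1)"
      using powr_Suc_diff[of K "- s"] by auto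
    have "real (Suc K) powr (- s - 1) \<le> z powr (- s - 1)"
      using z assms by (intro powr_mono2') auto
    hence "s * real (Suc K) powr (- s - 1) \<le> s * z powr (- s - 1)" using assms by simp
    hence "s * real (Suc K) powr (- s - 1) \<le> real K powr - s - real (Suc K) powr - s"
      using z by linarith
    hence "real (Suc K) powr (- s - 1) \<le> (real K powr - s - real (Suc K) powr - s) / s"
      using assms by (simp add: field_simps)
    thus ?case using step by (simp add: diff_divide_distrib)
  qed simp
  moreover have "(real m powr - s - real K powr - s) / s \<le> real m powr - s / s"
    using assms by (simp add: divide_right_mono)
  ultimately show ?thesis by (cases "m \<le> K") (use assms in auto)
qed

text \<open>Split at k = n: the denominator is at least n+1 on the head and at least k+1 on the
  tail. The head yields the constant 1/(1-s), the tail 1/s.\<close>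

lemma sum_powr_hilbert_kernel_le:
  fixes s :: real
  assumes s: "0 < s" "s < 1"
  shows "(\<Sum>k<K. real (Suc k) powr - s / real (n + Suc k)) \<le> (1 / s + 1 / (1 - s)) * real (Suc n) powr - s"
proof -
  have le: "real (Suc k) powr - s / real (n + Suc k) \<le>
      (if k \<le> n then real (Suc k) powr - s / real (Suc n) else real (Suc k) powr (- s - 1))" for k
  proof -
    have "real (Suc k) powr (- s - 1) = real (Suc k) powr - s / real (Suc k)"
      by (simp add: powr_diff)
    thus ?thesis
      using s by (auto intro!: divide_left_mono simp del: of_nat_Suc)
  qed
  have "(\<Sum>k<K. real (Suc k) powr - s / real (n + Suc k)) \<le>
      (\<Sum>k<K. if k \<le> n then real (Suc k) powr - s / real (Suc n) else real (Suc k) powr (- s - 1))"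
    by (intro sum_mono le)
  \<comment> \<open>The range is enlarged so that it contains the whole head, whatever the size of
    \<open>K\<close>.\<close>
  also have "\<dots> \<le> (\<Sum>k<Suc n + K. if k \<le> n then real (Suc k) powr - s / real (Suc n)
      else real (Suc k) powr (- s - 1))"
    by (intro sum_mono2) auto
  also have "{..<Suc n + K} = {..<Suc n} \<union> {Suc n..<Suc n + K}" by auto
  also have "(\<Sum>k\<in>{..<Suc n} \<union> {Suc n..<Suc n + K}. if k \<le> n then real (Suc k) powr - s / real (Suc n)
      else real (Suc k) powr (- s - 1)) =
      (\<Sum>k<Suc n. real (Suc k) powr - s) / real (Suc n) +
      (\<Sum>k=Suc n..<Suc n + K. real (Suc k) powr (- s - 1))"
    unfolding sum_divide_distrib by (subst sum.union_disjoint) (auto intro!: arg_cong2[where f = "(+)"] sum.cong simp del: of_nat_Suc)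
  also have "\<dots> \<le> real (Suc n) powr (1 - s) / (1 - s) / real (Suc n) + real (Suc n) powr - s / s"
    by (intro add_mono divide_right_mono sum_powr_le sum_powr_tail_le) (use s in auto)
  also have "real (Suc n) powr (1 - s) = real (Suc n) powr - s * real (Suc n)"
    by (simp add: powr_diff powr_minus field_simps)
  also have "real (Suc n) powr - s * real (Suc n) / (1 - s) / real (Suc n) + real (Suc n) powr - s / s
     = (1 / s + 1 / (1 - s)) * real (Suc n) powr - s"
  proof -
    have "m \<noteq> 0 \<Longrightarrow> x * m / c / m + x / s = (1 / s + 1 / c) * x" for x m c :: real
      by (simp add: distrib_right)
    from this[of "real (Suc n)"] show ?thesis by (simp del: of_nat_Suc)
  qed
  finally show ?thesis .
qed

section \<open>Sums over dyadic scales\<close>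

lemma two_powr_nat_mult: "2 powr (real N * p) = (2 ^ N :: real) powr p"
  by (simp add: powr_powr flip: powr_realpow)

lemma sum_geometric_powr_le:
  fixes t :: real
  assumes "0 < t"
  shows "(\<Sum>i<n. 2 powr - (real i * t)) \<le> 1 / (1 - 2 powr - t)"
proof -
  have "2 powr - (real i * t) = (2 powr - t) ^ i" for i
    by (simp add: powr_powr mult.commute flip: powr_realpow)
  moreover have "2 powr - t < (1::real)" using assms by (simp add: powr_less_one)
  ultimately show ?thesis
    using assms by (simp add: sum_gp_strict divide_right_mono)
qed

text \<open>The terms peak where \<open>2 ^ N\<close> is about \<open>x\<close>. Below that scale
  the denominator is at least \<open>x\<close>, above it at least \<open>2 ^ N\<close>; on both
  sides the terms are dominated by geometric series, of ratios \<open>2 powr - s\<close> and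
  \<open>2 powr - (1 - s)\<close>.\<close>

lemma sum_two_powr_kernel_le:
  fixes s x :: real
  assumes s: "0 < s" "s < 1" and x: "x \<ge> 1"
  shows "(\<Sum>N<L. 2 powr (real N * s) / (2 ^ N + x)) \<le>
           (1 / (1 - 2 powr - s) + 1 / (1 - 2 powr - (1 - s))) * x powr (s - 1)"
proof -
  \<comment> \<open>The critical scale: \<open>2 ^ J\<close> \<le> \<open>x\<close> \<le>
    \<open>2 ^ Suc J\<close>. The lower bound serves the positive exponent \<open>s\<close>, the
    upper bound the negative exponent \<open>s - 1\<close>.\<close>
  define J where "J = nat \<lfloor>log 2 x\<rfloor>"
  have J0: "0 \<le> log 2 x" using x by (simp add: zero_le_log_cancel_iff)
  have "real J \<le> log 2 x" "log 2 x \<le> real (Suc J)"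
    using J0 unfolding J_def by linarith+
  hence J: "2 powr real J \<le> x" "x \<le> 2 powr real (Suc J)"
    using x by (auto simp: le_log_iff log_le_iff simp del: of_nat_Suc)
  have small: "2 powr (real N * s) / (2 ^ N + x) \<le> 2 powr - (real (J - N) * s) * x powr (s - 1)"
    if "N \<le> J" for N
  proof -
    have "2 powr (real N * s) / (2 ^ N + x) \<le> 2 powr (real N * s) / x"
      using x by (intro divide_left_mono) (auto intro!: mult_pos_pos add_pos_pos)
    also have "\<dots> = 2 powr - (real (J - N) * s) * (2 powr real J) powr s / x"
      using that by (simp add: powr_powr of_nat_diff algebra_simps flip: powr_add)
    also have "\<dots> \<le> 2 powr - (real (J - N) * s) * x powr s / x"
      using J x s by (intro divide_right_mono mult_left_mono powr_mono2) auto
    finally show ?thesis using x by (simp add: powr_diff)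
  qed
  have large: "2 powr (real N * s) / (2 ^ N + x) \<le> 2 powr - (real (N - Suc J) * (1 - s)) * x powr (s - 1)"
    if "N \<ge> Suc J" for N
  proof -
    have "2 powr (real N * s) / (2 ^ N + x) \<le> 2 powr (real N * s) / 2 ^ N"
      using x by (intro divide_left_mono) (auto intro!: mult_pos_pos add_pos_pos)
    also have "\<dots> = 2 powr (real N * s - real N)"
      by (simp add: powr_diff powr_realpow)
    also have "\<dots> = 2 powr - (real (N - Suc J) * (1 - s)) * (2 powr real (Suc J)) powr (s - 1)"
      using that by (simp add: powr_powr of_nat_diff algebra_simps flip: powr_add)
    also have "\<dots> \<le> 2 powr - (real (N - Suc J) * (1 - s)) * x powr (s - 1)"
      using J x s by (intro mult_left_mono powr_mono2') auto
    finally show ?thesis .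
  qed
  have "(\<Sum>N<L. 2 powr (real N * s) / (2 ^ N + x)) \<le> (\<Sum>N<Suc J + L. 2 powr (real N * s) / (2 ^ N + x))"
    using x by (intro sum_mono2) (auto intro!: divide_nonneg_pos add_pos_pos)
  also have "{..<Suc J + L} = {..<Suc J} \<union> {Suc J..<Suc J + L}" by auto
  also have "(\<Sum>N\<in>\<dots>. 2 powr (real N * s) / (2 ^ N + x)) =
      (\<Sum>N<Suc J. 2 powr (real N * s) / (2 ^ N + x)) + (\<Sum>N=Suc J..<Suc J + L. 2 powr (real N * s) / (2 ^ N + x))"
    by (rule sum.union_disjoint) auto
  also have "\<dots> \<le> (\<Sum>N<Suc J. 2 powr - (real (J - N) * s) * x powr (s - 1)) +
      (\<Sum>N=Suc J..<Suc J + L. 2 powr - (real (N - Suc J) * (1 - s)) * x powr (s - 1))"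
    by (intro add_mono sum_mono small large) auto
  also have "(\<Sum>N<Suc J. 2 powr - (real (J - N) * s) * x powr (s - 1)) =
      (\<Sum>i<Suc J. 2 powr - (real i * s)) * x powr (s - 1)"
    unfolding sum_distrib_right by (subst sum.nat_diff_reindex[symmetric]) simp
  also have "(\<Sum>N=Suc J..<Suc J + L. 2 powr - (real (N - Suc J) * (1 - s)) * x powr (s - 1)) =
      (\<Sum>i<L. 2 powr - (real i * (1 - s))) * x powr (s - 1)"
    unfolding sum_distrib_right
    by (rule sum.reindex_bij_witness[of _ "\<lambda>i. i + Suc J" "\<lambda>N. N - Suc J"]) auto
  also have "(\<Sum>i<Suc J. 2 powr - (real i * s)) * x powr (s - 1) + (\<Sum>i<L. 2 powr - (real i * (1 - s))) * x powr (s - 1)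
     \<le> 1 / (1 - 2 powr - s) * x powr (s - 1) + 1 / (1 - 2 powr - (1 - s)) * x powr (s - 1)"
    by (intro add_mono mult_right_mono sum_geometric_powr_le) (use s in auto)
  finally show ?thesis by (simp add: algebra_simps)
qed

text \<open>The product of the two Schur constants: the first factor belongs to the sum over the
  coefficient index k, the second to the sum over the dyadic scales N.\<close>

definition hilbert_const :: "real \<Rightarrow> real" where
  "hilbert_const s = (1 / s + 1 / (1 - s)) * (1 / (1 - 2 powr - s) + 1 / (1 - 2 powr - (1 - s)))"

lemma hilbert_const_pos:
  assumes "0 < s" "s < 1"
  shows "hilbert_const s > 0"
proof -
  have "2 powr - s < (1::real)" "2 powr - (1 - s) < (1::real)"
    using assms by (simp_all add: powr_less_one del: minus_diff_eq)
  thus ?thesis using assms unfolding hilbert_const_def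
    by (intro mult_pos_pos add_pos_pos divide_pos_pos) auto
qed

text \<open>Schur test with the weights \<open>(k + 1) powr s\<close>.\<close>

lemma dyadic_hilbert_ineq_finite:
  fixes a :: "nat \<Rightarrow> real" and s :: real
  assumes s: "0 < s" "s < 1" and a: "\<And>k. a k \<ge> 0"
  shows "(\<Sum>N<L. 2 powr (real N * (2 * s)) * (\<Sum>k<K. a k / real (2 ^ N + Suc k))\<^sup>2) \<le>
           hilbert_const s * (\<Sum>k<K. real (Suc k) powr (2 * s - 1) * (a k)\<^sup>2)"
proof -
  define C1 where "C1 = 1 / s + 1 / (1 - s)"
  define C2 where "C2 = 1 / (1 - 2 powr - s) + 1 / (1 - 2 powr - (1 - s))"
  have C1: "C1 \<ge> 0" using s by (simp add: C1_def)
  have cs: "(\<Sum>k<K. a k / real (n + Suc k))\<^sup>2 \<le>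
     C1 * real n powr - s * (\<Sum>k<K. real (Suc k) powr s * (a k)\<^sup>2 / real (n + Suc k))" if n: "n > 0" for n
  proof -
    \<comment> \<open>Splitting of the terms for Cauchy-Schwarz: the weight
      \<open>real (Suc k) powr - s\<close> turns the first factor into the kernel sum already
      estimated.\<close>
    have eq: "(\<Sum>k<K. a k / real (n + Suc k)) =
       (\<Sum>k<K. sqrt (real (Suc k) powr - s / real (n + Suc k)) * sqrt (real (Suc k) powr s * (a k)\<^sup>2 / real (n + Suc k)))"
    proof (rule sum.cong)
      fix k
      have "sqrt (real (Suc k) powr - s / real (n + Suc k)) * sqrt (real (Suc k) powr s * (a k)\<^sup>2 / real (n + Suc k))
        = sqrt ((a k / real (n + Suc k))\<^sup>2)"
        unfolding real_sqrt_mult[symmetric]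
        by (rule arg_cong[where f = sqrt]) (simp add: powr_minus field_simps power2_eq_square del: of_nat_Suc of_nat_add)
      thus "a k / real (n + Suc k) = sqrt (real (Suc k) powr - s / real (n + Suc k)) * sqrt (real (Suc k) powr s * (a k)\<^sup>2 / real (n + Suc k))"
        using a[of k] by simp
    qed auto
    have "(\<Sum>k<K. a k / real (n + Suc k))\<^sup>2 \<le> (\<Sum>k<K. (sqrt (real (Suc k) powr - s / real (n + Suc k)))\<^sup>2) *
        (\<Sum>k<K. (sqrt (real (Suc k) powr s * (a k)\<^sup>2 / real (n + Suc k)))\<^sup>2)"
      unfolding eq by (rule Cauchy_Schwarz_ineq_sum)
    also have "\<dots> = (\<Sum>k<K. real (Suc k) powr - s / real (n + Suc k)) *
        (\<Sum>k<K. real (Suc k) powr s * (a k)\<^sup>2 / real (n + Suc k))"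
      by (simp only: real_sqrt_pow2 divide_nonneg_nonneg powr_ge_zero of_nat_0_le_iff mult_nonneg_nonneg zero_le_power2)
    also have "\<dots> \<le> (C1 * real n powr - s) * (\<Sum>k<K. real (Suc k) powr s * (a k)\<^sup>2 / real (n + Suc k))"
    proof (intro mult_right_mono sum_nonneg)
      have "(\<Sum>k<K. real (Suc k) powr - s / real (n + Suc k)) \<le> C1 * real (Suc n) powr - s"
        using sum_powr_hilbert_kernel_le[OF s] by (simp add: C1_def)
      \<comment> \<open>Weakened from n+1 to n so that n = \<open>2 ^ N\<close> gives an exact power
        of 2.\<close>
      also have "\<dots> \<le> C1 * real n powr - s"
        using s n C1 by (intro mult_left_mono powr_mono2') auto
      finally show "(\<Sum>k<K. real (Suc k) powr - s / real (n + Suc k)) \<le> C1 * real n powr - s" .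
    qed auto
    finally show ?thesis .
  qed
  have "(\<Sum>N<L. 2 powr (real N * (2 * s)) * (\<Sum>k<K. a k / real (2 ^ N + Suc k))\<^sup>2) \<le>
    (\<Sum>N<L. 2 powr (real N * (2 * s)) * (C1 * real (2 ^ N) powr - s * (\<Sum>k<K. real (Suc k) powr s * (a k)\<^sup>2 / real (2 ^ N + Suc k))))"
    by (intro sum_mono mult_left_mono cs) auto
  also have "\<dots> = (\<Sum>N<L. \<Sum>k<K. C1 * (real (Suc k) powr s * (a k)\<^sup>2) * (2 powr (real N * s) / (2 ^ N + real (Suc k))))"
  proof (intro sum.cong refl)
    fix N
    have "2 powr (real N * (2 * s)) * real (2 ^ N) powr - s = 2 powr (real N * s)"
      by (simp add: two_powr_nat_mult flip: powr_add)
    hence "2 powr (real N * (2 * s)) * (C1 * real (2 ^ N) powr - s * X) = C1 * 2 powr (real N * s) * X" for X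
      by (metis mult.assoc mult.commute)
    hence "2 powr (real N * (2 * s)) * (C1 * real (2 ^ N) powr - s * (\<Sum>k<K. real (Suc k) powr s * (a k)\<^sup>2 / real (2 ^ N + Suc k)))
      = C1 * 2 powr (real N * s) * (\<Sum>k<K. real (Suc k) powr s * (a k)\<^sup>2 / real (2 ^ N + Suc k))" .
    also have "\<dots> = (\<Sum>k<K. C1 * (real (Suc k) powr s * (a k)\<^sup>2) * (2 powr (real N * s) / (2 ^ N + real (Suc k))))"
      unfolding sum_distrib_left
      by (intro sum.cong refl) (simp add: mult_ac del: of_nat_Suc add_Suc_right)
    finally show "2 powr (real N * (2 * s)) * (C1 * real (2 ^ N) powr - s * (\<Sum>k<K. real (Suc k) powr s * (a k)\<^sup>2 / real (2 ^ N + Suc k)))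
      = (\<Sum>k<K. C1 * (real (Suc k) powr s * (a k)\<^sup>2) * (2 powr (real N * s) / (2 ^ N + real (Suc k))))" .
  qed
  \<comment> \<open>After the interchange the inner sum runs over the scales N, and
    \<open>sum_two_powr_kernel_le\<close> applies with x = k+1.\<close>
  also have "\<dots> = (\<Sum>k<K. C1 * (real (Suc k) powr s * (a k)\<^sup>2) * (\<Sum>N<L. 2 powr (real N * s) / (2 ^ N + real (Suc k))))"
    by (subst sum.swap) (simp add: sum_distrib_left)
  also have "\<dots> \<le> (\<Sum>k<K. C1 * (real (Suc k) powr s * (a k)\<^sup>2) * (C2 * real (Suc k) powr (s - 1)))"
    unfolding C2_def by (intro sum_mono mult_left_mono sum_two_powr_kernel_le s) (use C1 in auto)
  also have "\<dots> = hilbert_const s * (\<Sum>k<K. real (Suc k) powr (2 * s - 1) * (a k)\<^sup>2)"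
  proof -
    have "2 * s - 1 = s + (s - 1)" by simp
    hence "real (Suc k) powr (2 * s - 1) = real (Suc k) powr s * real (Suc k) powr (s - 1)" for k
      by (simp only: powr_add)
    thus ?thesis by (simp add: hilbert_const_def C1_def C2_def sum_distrib_left mult_ac del: of_nat_Suc)
  qed
  finally show ?thesis .
qed

text \<open>The finite inequality is uniform in \<open>K\<close>, so it passes to the limit once the
  inner series converge; their convergence is itself read off from the term N = 0 of the finite
  inequality.\<close>

lemma dyadic_hilbert_ineq:
  fixes a :: "nat \<Rightarrow> real" and s :: real
  assumes s: "0 < s" "s < 1" and a: "\<And>k. a k \<ge> 0"
    and Q: "\<And>K. (\<Sum>k<K. real (Suc k) powr (2 * s - 1) * (a k)\<^sup>2) \<le> Q"
  shows "summable (\<lambda>k. a k / real (n + Suc k))"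
    and "(\<Sum>N<L. 2 powr (real N * (2 * s)) * (\<Sum>k. a k / real (2 ^ N + Suc k))\<^sup>2) \<le> hilbert_const s * Q"
proof -
  have fin: "(\<Sum>N<L. 2 powr (real N * (2 * s)) * (\<Sum>k<K. a k / real (2 ^ N + Suc k))\<^sup>2) \<le> hilbert_const s * Q"
    for K L
    using dyadic_hilbert_ineq_finite[OF s a, where L = L and K = K] Q[of K] hilbert_const_pos[OF s]
    by (meson mult_left_mono order_trans less_imp_le)
  have sum1: "summable (\<lambda>k. a k / real (1 + Suc k))"
  proof (rule bounded_imp_summable)
    fix K
    have "(\<Sum>k<Suc K. a k / real (1 + Suc k))\<^sup>2 \<le> hilbert_const s * Q"
      using fin[where L = 1 and K = "Suc K"] by simp
    thus "(\<Sum>k\<le>K. a k / real (1 + Suc k)) \<le> sqrt (hilbert_const s * Q)"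
      unfolding lessThan_Suc_atMost by (rule real_le_rsqrt)
  qed (use a in auto)
  show sm: "summable (\<lambda>k. a k / real (n + Suc k))" for n
  proof (rule summable_comparison_test'[OF summable_mult[OF sum1, of 2]])
    fix k
    \<comment> \<open>The factor 2 covers n = 0, where the denominator k+1 is smaller than the k+2
      of the series known to converge.\<close>
    have "a k / real (n + Suc k) \<le> a k / (real (1 + Suc k) / 2)"
      using a by (intro divide_left_mono) auto
    thus "norm (a k / real (n + Suc k)) \<le> 2 * (a k / real (1 + Suc k))" using a[of k] by (simp add: mult.commute)
  qed
  have "(\<lambda>K. \<Sum>N<L. 2 powr (real N * (2 * s)) * (\<Sum>k<K. a k / real (2 ^ N + Suc k))\<^sup>2) \<longlonglongrightarrow>
        (\<Sum>N<L. 2 powr (real N * (2 * s)) * (\<Sum>k. a k / real (2 ^ N + Suc k))\<^sup>2)"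
    by (intro tendsto_intros summable_LIMSEQ sm)
  thus "(\<Sum>N<L. 2 powr (real N * (2 * s)) * (\<Sum>k. a k / real (2 ^ N + Suc k))\<^sup>2) \<le> hilbert_const s * Q"
    by (rule LIMSEQ_le_const2) (use fin in auto)
qed

section \<open>Total boundedness in the spaces \<open>D2 \<gamma>\<close>\<close>

abbreviation taylor_coeff :: "(complex \<Rightarrow> complex) \<Rightarrow> nat \<Rightarrow> complex" where
  "taylor_coeff h n \<equiv> fps_nth (fps_expansion h 0) n"

text \<open>The square root of the weight in the norm, so that the norm is a weighted l2 norm of the
  Taylor coefficients. Index 0 is set apart because \<open>0 powr p\<close> is 0, which would lose
  the constant term.\<close>

definition D2_weight :: "real \<Rightarrow> nat \<Rightarrow> real" where
  "D2_weight \<gamma> n = (if n = 0 then 1 else sqrt (real n powr (1 - \<gamma>)))"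

lemma D2_seq_eq: "D2_seq \<gamma> h n = D2_weight \<gamma> n * cmod (taylor_coeff h n)"
  by (simp add: D2_seq_def D2_weight_def)

lemma D2_weight_pos [simp]: "D2_weight \<gamma> n > 0"
  by (simp add: D2_weight_def)

lemma D2_weight_nonneg [simp]: "D2_weight \<gamma> n \<ge> 0"
  by (rule less_imp_le) simp

lemma D2_weight_square: "n > 0 \<Longrightarrow> (D2_weight \<gamma> n)\<^sup>2 = real n powr (1 - \<gamma>)"
  by (simp add: D2_weight_def)

text \<open>Uniqueness of power series: it identifies the coefficients both of functions built from
  a sequence and of \<open>gen_hilbert g f\<close>.\<close>

lemma power_series_on_disc:
  assumes sums: "\<And>z. z \<in> ball 0 1 \<Longrightarrow> (\<lambda>n. c n * z ^ n) sums h z"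
  shows "h holomorphic_on ball 0 1" and "taylor_coeff h n = c n"
proof -
  show "h holomorphic_on ball 0 1"
    by (rule power_series_holomorphic[where a = c]) (use sums in simp)
  have "h has_fps_expansion Abs_fps c"
  proof (rule has_fps_expansionI)
    have "eventually (\<lambda>u::complex. u \<in> ball 0 1) (nhds 0)"
      by (intro eventually_nhds_in_open) auto
    thus "eventually (\<lambda>u. (\<lambda>n. fps_nth (Abs_fps c) n * u ^ n) sums h u) (nhds 0)"
      by eventually_elim (use sums in simp)
  qed
  from fps_nth_fps_expansion[OF this, of n] show "taylor_coeff h n = c n"
    by (simp add: fps_expansion_def)
qed

lemma taylor_sums_on_disc:
  assumes "h holomorphic_on ball 0 1" "z \<in> ball 0 1"
  shows "(\<lambda>n. taylor_coeff h n * z ^ n) sums h z"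
  using holomorphic_power_series[OF assms] by (simp add: fps_expansion_def)

text \<open>With q the (m+1)-st root of r the term equals \<open>(n * q ^ n) ^ m * q ^ n\<close>,
  where \<open>n * q ^ n\<close> is bounded.\<close>

lemma summable_power_times_geometric:
  fixes r :: real
  assumes r: "0 \<le> r" "r < 1"
  shows "summable (\<lambda>n. real n ^ m * r ^ n)"
proof -
  define q where "q = root (Suc m) r"
  have q: "0 \<le> q" "q < 1" "q ^ Suc m = r"
    using r by (simp_all add: q_def del: power_Suc)
  have "(\<lambda>n. real n * q ^ n) \<longlonglongrightarrow> 0"
    by (rule powser_times_n_limit_0) (use q in simp)
  hence "Bseq (\<lambda>n. real n * q ^ n)"
    by (rule convergent_imp_Bseq[OF convergentI])
  then obtain B where B: "\<And>n. \<bar>real n * q ^ n\<bar> \<le> B"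
    by (auto simp: Bseq_def)
  have "summable (\<lambda>n. B ^ m * q ^ n)"
    by (intro summable_mult summable_geometric) (use q in simp)
  thus ?thesis
  proof (rule summable_comparison_test')
    fix n
    have "real n ^ m * r ^ n = (real n * q ^ n) ^ m * q ^ n"
      unfolding q(3)[symmetric] by (simp add: power_mult_distrib mult.commute flip: power_mult power_add)
    also have "\<dots> \<le> B ^ m * q ^ n"
      using B[of n] q by (intro mult_right_mono power_mono) auto
    finally show "norm (real n ^ m * r ^ n) \<le> B ^ m * q ^ n"
      using r by simp
  qed
qed

text \<open>The weighted coefficients are bounded and the weight is at least
  \<open>1 / n ^ m\<close> for n > 0, so the coefficients grow at most polynomially.\<close>

lemma summable_power_series_of_weighted:
  assumes sm: "summable (\<lambda>n. (D2_weight \<gamma> n * cmod (c n))\<^sup>2)" and z: "cmod z < 1"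
  shows "summable (\<lambda>n. c n * z ^ n)"
proof -
  have "Bseq (\<lambda>n. (D2_weight \<gamma> n * cmod (c n))\<^sup>2)"
    by (rule convergent_imp_Bseq[OF convergentI[OF summable_LIMSEQ_zero[OF sm]]])
  then obtain B where B: "\<And>n. (D2_weight \<gamma> n * cmod (c n))\<^sup>2 \<le> B"
    by (auto simp: Bseq_def)
  define m where "m = nat \<lceil>\<bar>1 - \<gamma>\<bar>\<rceil>"
  have "\<bar>1 - \<gamma>\<bar> \<le> real m" unfolding m_def by (rule real_nat_ceiling_ge)
  hence m: "0 \<le> (1 - \<gamma>) / 2 + real m" by (simp add: abs_le_iff field_simps)
  have wt: "1 \<le> D2_weight \<gamma> n * real n ^ m" if "n > 0" for n
  proof -
    have "1 \<le> real n powr ((1 - \<gamma>) / 2 + real m)"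
      using that m by (intro ge_one_powr_ge_zero) auto
    also have "\<dots> = D2_weight \<gamma> n * real n ^ m"
      using that by (simp add: D2_weight_def powr_half_sqrt_powr powr_add powr_realpow)
    finally show ?thesis .
  qed
  have "summable (\<lambda>n. sqrt B * (real n ^ m * cmod z ^ n))"
    by (intro summable_mult summable_power_times_geometric) (use z in auto)
  thus ?thesis
  proof (rule summable_comparison_test'[where N = 1])
    fix n :: nat assume n: "n \<ge> 1"
    have "cmod (c n) \<le> (D2_weight \<gamma> n * real n ^ m) * cmod (c n)"
      using wt[of n] n by (simp add: mult_le_cancel_right1)
    also have "\<dots> = (D2_weight \<gamma> n * cmod (c n)) * real n ^ m" by simp
    also have "\<dots> \<le> sqrt B * real n ^ m"
      using B[of n] by (intro mult_right_mono real_le_rsqrt) auto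
    finally show "norm (c n * z ^ n) \<le> sqrt B * (real n ^ m * cmod z ^ n)"
      by (simp add: norm_mult norm_power mult_right_mono flip: mult.assoc)
  qed
qed

text \<open>Every weighted square-summable sequence comes from an element of
  \<open>D2 \<gamma>\<close>. This supplies the limits in the completeness proof and the test
  functions.\<close>

lemma D2_of_coeffs:
  assumes "summable (\<lambda>n. (D2_weight \<gamma> n * cmod (c n))\<^sup>2)"
  obtains h where "h \<in> D2 \<gamma>" "\<And>n. taylor_coeff h n = c n"
proof -
  define h where "h z = (if z \<in> ball 0 1 then \<Sum>n. c n * z ^ n else 0)" for z
  have sums: "(\<lambda>n. c n * z ^ n) sums h z" if "z \<in> ball 0 1" for z
    using summable_power_series_of_weighted[OF assms, of z] that by (simp add: h_def summable_sums)
  note h = power_series_on_disc[OF sums]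
  have "h \<in> D2 \<gamma>"
    using h assms by (simp add: D2_iff_seq D2_seq_eq) (simp add: h_def)
  thus ?thesis using h(2) by (rule that)
qed

lemma D2_summable: "h \<in> D2 \<gamma> \<Longrightarrow> summable (\<lambda>n. (D2_weight \<gamma> n * cmod (taylor_coeff h n))\<^sup>2)"
  by (simp add: D2_iff_seq D2_seq_eq)

section \<open>The metric as a weighted l2 distance, and completeness\<close>

text \<open>Taylor coefficients embed \<open>D2 \<gamma>\<close> isometrically into a weighted l2
  space; the metric arguments below work with coefficients through this identity.\<close>

lemma D2_dist_square:
  assumes "f \<in> D2 \<gamma>" "h \<in> D2 \<gamma>"
  shows "(\<lambda>n. (D2_weight \<gamma> n * cmod (taylor_coeff f n - taylor_coeff h n))\<^sup>2) sums (D2_dist \<gamma> f h)\<^sup>2"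
proof -
  have sm: "summable (\<lambda>n. (D2_seq \<gamma> (\<lambda>z. f z - h z) n)\<^sup>2)"
    using D2_diff[OF assms] by (simp add: D2_iff_seq)
  have "(D2_dist \<gamma> f h)\<^sup>2 = (\<Sum>n. (D2_seq \<gamma> (\<lambda>z. f z - h z) n)\<^sup>2)"
    using assms D2_norm_seq[OF sm] sm by (simp add: D2_dist_def suminf_nonneg)
  with sm show ?thesis
    unfolding D2_seq_eq D2_coeff_diff[OF assms] by (simp add: summable_sums)
qed

lemma D2_partial_sum_le_dist:
  assumes "f \<in> D2 \<gamma>" "h \<in> D2 \<gamma>" "finite A"
  shows "(\<Sum>n\<in>A. (D2_weight \<gamma> n * cmod (taylor_coeff f n - taylor_coeff h n))\<^sup>2) \<le> (D2_dist \<gamma> f h)\<^sup>2"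
  unfolding sums_unique[OF D2_dist_square[OF assms(1,2)]]
  by (rule sum_le_suminf[OF sums_summable[OF D2_dist_square[OF assms(1,2)]] assms(3)]) simp

lemma D2_dist_le:
  assumes "f \<in> D2 \<gamma>" "h \<in> D2 \<gamma>" "\<epsilon> \<ge> 0"
    and "\<And>K. (\<Sum>n<K. (D2_weight \<gamma> n * cmod (taylor_coeff f n - taylor_coeff h n))\<^sup>2) \<le> \<epsilon>\<^sup>2"
  shows "D2_dist \<gamma> f h \<le> \<epsilon>"
proof -
  have "(D2_dist \<gamma> f h)\<^sup>2 \<le> \<epsilon>\<^sup>2"
    using LIMSEQ_le_const2[OF D2_dist_square[OF assms(1,2), unfolded sums_def]] assms(4) by blast
  thus ?thesis using assms(3) by (rule power2_le_imp_le)
qed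

lemma D2_coeff_le_dist:
  assumes "f \<in> D2 \<gamma>" "h \<in> D2 \<gamma>"
  shows "D2_weight \<gamma> n * cmod (taylor_coeff f n - taylor_coeff h n) \<le> D2_dist \<gamma> f h"
proof (rule power2_le_imp_le)
  show "(D2_weight \<gamma> n * cmod (taylor_coeff f n - taylor_coeff h n))\<^sup>2 \<le> (D2_dist \<gamma> f h)\<^sup>2"
    using D2_partial_sum_le_dist[OF assms, of "{n}"] by simp
  show "0 \<le> D2_dist \<gamma> f h"
    using Metric_space.nonneg[OF Metric_space_D2] .
qed

text \<open>As for l2: a Cauchy sequence converges in each coefficient, the limiting sequence is
  weighted square-summable, and the function it defines is the limit.\<close>

lemma mcomplete_D2: "Metric_space.mcomplete (D2 \<gamma>) (D2_dist \<gamma>)"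
proof -
  interpret Metric_space "D2 \<gamma>" "D2_dist \<gamma>" by (rule Metric_space_D2)
  show ?thesis unfolding mcomplete_def
  proof (intro allI impI)
    fix \<sigma> assume "MCauchy \<sigma>"
    hence \<sigma>: "\<And>i. \<sigma> i \<in> D2 \<gamma>" and
      C: "\<And>\<epsilon>. \<epsilon> > 0 \<Longrightarrow> \<exists>N. \<forall>i\<ge>N. \<forall>j\<ge>N. D2_dist \<gamma> (\<sigma> i) (\<sigma> j) < \<epsilon>"
      by (auto simp: MCauchy_def)
    have "convergent (\<lambda>i. taylor_coeff (\<sigma> i) n)" for n
    proof (rule Cauchy_convergent, rule metric_CauchyI)
      fix \<epsilon> :: real assume "\<epsilon> > 0"
      with C[of "D2_weight \<gamma> n * \<epsilon>"] obtain N
        where N: "\<forall>i\<ge>N. \<forall>j\<ge>N. D2_dist \<gamma> (\<sigma> i) (\<sigma> j) < D2_weight \<gamma> n * \<epsilon>" by auto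
      have "dist (taylor_coeff (\<sigma> i) n) (taylor_coeff (\<sigma> j) n) < \<epsilon>" if "i \<ge> N" "j \<ge> N" for i j
        using N[rule_format, OF that] D2_coeff_le_dist[OF \<sigma> \<sigma>, of n i j]
          mult_less_cancel_left_pos[OF D2_weight_pos[of \<gamma> n]]
        by (metis dist_norm order_le_less_trans)
      thus "\<exists>N. \<forall>i\<ge>N. \<forall>j\<ge>N. dist (taylor_coeff (\<sigma> i) n) (taylor_coeff (\<sigma> j) n) < \<epsilon>" by blast
    qed
    then obtain c where c: "\<And>n. (\<lambda>i. taylor_coeff (\<sigma> i) n) \<longlonglongrightarrow> c n"
      unfolding convergent_def by metis
    \<comment> \<open>The second index tends to infinity with \<open>K\<close> fixed, so the bound
      for the distance to the limit is uniform in \<open>K\<close>.\<close>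
    have lim: "(\<Sum>n<K. (D2_weight \<gamma> n * cmod (taylor_coeff (\<sigma> i) n - c n))\<^sup>2) \<le> \<epsilon>\<^sup>2"
      if N: "\<forall>i\<ge>N. \<forall>j\<ge>N. D2_dist \<gamma> (\<sigma> i) (\<sigma> j) < \<epsilon>" and i: "i \<ge> N" for N \<epsilon> i K
    proof (rule LIMSEQ_le_const2)
      show "(\<lambda>j. \<Sum>n<K. (D2_weight \<gamma> n * cmod (taylor_coeff (\<sigma> i) n - taylor_coeff (\<sigma> j) n))\<^sup>2)
         \<longlonglongrightarrow> (\<Sum>n<K. (D2_weight \<gamma> n * cmod (taylor_coeff (\<sigma> i) n - c n))\<^sup>2)"
        by (intro tendsto_intros c)
      have "(\<Sum>n<K. (D2_weight \<gamma> n * cmod (taylor_coeff (\<sigma> i) n - taylor_coeff (\<sigma> j) n))\<^sup>2) \<le> \<epsilon>\<^sup>2"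
        if "j \<ge> N" for j
        using D2_partial_sum_le_dist[OF \<sigma> \<sigma>, of "{..<K}" i j] N i that
          power_mono[OF less_imp_le nonneg, of "\<sigma> i" "\<sigma> j" \<epsilon> 2] by fastforce
      thus "\<exists>N. \<forall>j\<ge>N. (\<Sum>n<K. (D2_weight \<gamma> n * cmod (taylor_coeff (\<sigma> i) n - taylor_coeff (\<sigma> j) n))\<^sup>2) \<le> \<epsilon>\<^sup>2"
        by blast
    qed
    \<comment> \<open>Tolerance 1 is enough here: \<open>c\<close> differs from the coefficients of
      the single element \<open>\<sigma> N1\<close> by a square-summable sequence.\<close>
    obtain N1 where N1: "\<forall>i\<ge>N1. \<forall>j\<ge>N1. D2_dist \<gamma> (\<sigma> i) (\<sigma> j) < 1"
      using C[of 1] by auto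
    have "summable (\<lambda>n. (D2_weight \<gamma> n * cmod (taylor_coeff (\<sigma> N1) n - c n))\<^sup>2)"
      using lim[OF N1 order_refl] by (intro summableI_nonneg_bounded[where x = "1\<^sup>2"]) auto
    hence "summable (\<lambda>n. (D2_weight \<gamma> n * cmod (taylor_coeff (\<sigma> N1) n) +
        D2_weight \<gamma> n * cmod (taylor_coeff (\<sigma> N1) n - c n))\<^sup>2)"
      by (intro sqrt_suminf_triangle D2_summable \<sigma>)
    hence "summable (\<lambda>n. (D2_weight \<gamma> n * cmod (c n))\<^sup>2)"
    proof (rule summable_comparison_test')
      fix n
      have "cmod (c n) \<le> cmod (taylor_coeff (\<sigma> N1) n) + cmod (taylor_coeff (\<sigma> N1) n - c n)"
        by (metis norm_minus_commute norm_triangle_sub)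
      thus "norm ((D2_weight \<gamma> n * cmod (c n))\<^sup>2) \<le> (D2_weight \<gamma> n * cmod (taylor_coeff (\<sigma> N1) n) +
        D2_weight \<gamma> n * cmod (taylor_coeff (\<sigma> N1) n - c n))\<^sup>2"
        unfolding real_norm_def abs_power2 distrib_left[symmetric]
        by (intro power_mono mult_left_mono) auto
    qed
    then obtain h where h: "h \<in> D2 \<gamma>" "\<And>n. taylor_coeff h n = c n"
      using D2_of_coeffs by blast
    have "\<exists>N. \<forall>i\<ge>N. \<sigma> i \<in> D2 \<gamma> \<and> D2_dist \<gamma> (\<sigma> i) h < \<epsilon>" if "\<epsilon> > 0" for \<epsilon>
    proof -
      from that have "\<epsilon> / 2 > 0" by simp
      from C[OF this] obtain N where N: "\<forall>i\<ge>N. \<forall>j\<ge>N. D2_dist \<gamma> (\<sigma> i) (\<sigma> j) < \<epsilon> / 2" ..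
      have "D2_dist \<gamma> (\<sigma> i) h \<le> \<epsilon> / 2" if "i \<ge> N" for i
        using lim[OF N that] \<open>\<epsilon> > 0\<close> h by (intro D2_dist_le \<sigma>) auto
      thus ?thesis using \<sigma> that by (intro exI[of _ N]) force
    qed
    hence "limitin mtopology \<sigma> h sequentially"
      using h by (simp add: limit_metric_sequentially)
    thus "\<exists>x. limitin mtopology \<sigma> x sequentially" by blast
  qed
qed

section \<open>Total boundedness and uniformly small tails\<close>

text \<open>A termwise substitute for the triangle inequality of the norm, applied under finite sums
  at the cost of a factor 2.\<close>

lemma square_mult_triangle:
  fixes x y z :: complex and w :: real
  shows "(w * cmod (x - z))\<^sup>2 \<le> 2 * (w * cmod (x - y))\<^sup>2 + 2 * (w * cmod (z - y))\<^sup>2"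
proof -
  have "(cmod (x - z))\<^sup>2 \<le> (cmod (x - y) + cmod (z - y))\<^sup>2"
    using norm_triangle_ineq4[of "x - y" "z - y"] by (intro power_mono) auto
  also have "\<dots> \<le> 2 * (cmod (x - y))\<^sup>2 + 2 * (cmod (z - y))\<^sup>2"
    using sum_squares_bound[of "cmod (x - y)" "cmod (z - y)"] unfolding power2_sum by linarith
  finally have "w\<^sup>2 * (cmod (x - z))\<^sup>2 \<le> w\<^sup>2 * (2 * (cmod (x - y))\<^sup>2 + 2 * (cmod (z - y))\<^sup>2)"
    by (intro mult_left_mono) auto
  thus ?thesis by (simp add: power_mult_distrib algebra_simps)
qed

text \<open>A diagonal argument gives a subsequence converging in each coefficient. It is Cauchy in
  the metric: finitely many coefficients are handled by convergence, the rest by the uniform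
  tails.\<close>

lemma D2_mtotally_boundedI:
  assumes S: "S \<subseteq> D2 \<gamma>"
    and bdd: "\<And>n. \<exists>B. \<forall>h\<in>S. cmod (taylor_coeff h n) \<le> B"
    and tail: "\<And>\<epsilon>. \<epsilon> > 0 \<Longrightarrow> \<exists>N. \<forall>h\<in>S. \<forall>M. (\<Sum>n=N..<M. (D2_weight \<gamma> n * cmod (taylor_coeff h n))\<^sup>2) \<le> \<epsilon>"
  shows "Metric_space.mtotally_bounded (D2 \<gamma>) (D2_dist \<gamma>) S"
proof -
  interpret Metric_space "D2 \<gamma>" "D2_dist \<gamma>" by (rule Metric_space_D2)
  obtain B where B: "\<And>n h. h \<in> S \<Longrightarrow> cmod (taylor_coeff h n) \<le> B n"
    using bdd by metis
  show ?thesis unfolding mtotally_bounded_sequentially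
  proof (intro conjI allI impI S)
    fix \<sigma> :: "nat \<Rightarrow> complex \<Rightarrow> complex" assume "range \<sigma> \<subseteq> S"
    hence \<sigma>: "\<And>i. \<sigma> i \<in> S" by auto
    have D: "\<And>i. \<sigma> i \<in> D2 \<gamma>" using \<sigma> S by auto
    \<comment> \<open>The diagonal lemma wants one bound for all n, hence the division by
      \<open>B n\<close>. Where \<open>B n = 0\<close> the quotient is 0 by convention, and the
      coefficients themselves vanish.\<close>
    have "norm (taylor_coeff (\<sigma> i) n / of_real (B n)) \<le> 1" for i n
    proof -
      have "cmod (taylor_coeff (\<sigma> i) n) \<le> \<bar>B n\<bar>" using B[OF \<sigma>[of i], of n] by linarith
      thus ?thesis by (simp add: norm_divide divide_le_eq)
    qed
    note subseq = function_convergent_subsequence[where S = UNIV and M = 1 and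
        f = "\<lambda>i n. taylor_coeff (\<sigma> i) n / of_real (B n)", OF countableI_type this]
    obtain r :: "nat \<Rightarrow> nat" where r: "strict_mono r"
      and conv: "\<And>n. n \<in> UNIV \<Longrightarrow> \<exists>l. (\<lambda>i. taylor_coeff (\<sigma> (r i)) n / of_real (B n)) \<longlonglongrightarrow> l"
      by (rule subseq) (rule that)
    have "\<exists>l. (\<lambda>i. taylor_coeff (\<sigma> (r i)) n) \<longlonglongrightarrow> l" for n
    proof (cases "B n = 0")
      case True
      hence "taylor_coeff (\<sigma> (r i)) n = 0" for i using B[OF \<sigma>, of "r i" n] by simp
      thus ?thesis by auto
    next
      case False
      obtain l where "(\<lambda>i. taylor_coeff (\<sigma> (r i)) n / of_real (B n)) \<longlonglongrightarrow> l"
        using conv[OF UNIV_I] ..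
      from tendsto_mult_right[OF this, of "of_real (B n)"] False show ?thesis by auto
    qed
    then obtain c where c: "\<And>n. (\<lambda>i. taylor_coeff (\<sigma> (r i)) n) \<longlonglongrightarrow> c n" by metis
    have "MCauchy (\<sigma> \<circ> r)" unfolding MCauchy_def
    proof (intro conjI allI impI)
      show "range (\<sigma> \<circ> r) \<subseteq> D2 \<gamma>" using D by auto
      fix \<epsilon> :: real assume \<epsilon>: "\<epsilon> > 0"
      \<comment> \<open>Head and tail contribute at most \<open>4 * \<delta>\<close> each, in total
        half of \<open>\<epsilon>\<^sup>2\<close>, which is below
        \<open>(3 * \<epsilon> / 4)\<^sup>2\<close> and leaves room for a strict inequality.\<close>
      define \<delta> where "\<delta> = (\<epsilon> / 4)\<^sup>2"
      have \<delta>: "\<delta> > 0" using \<epsilon> by (simp add: \<delta>_def)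
      obtain N where N: "\<And>h M. h \<in> S \<Longrightarrow> (\<Sum>n=N..<M. (D2_weight \<gamma> n * cmod (taylor_coeff h n))\<^sup>2) \<le> \<delta>"
        using tail[OF \<delta>] by blast
      have "(\<lambda>i. \<Sum>n<N. (D2_weight \<gamma> n * cmod (taylor_coeff (\<sigma> (r i)) n - c n))\<^sup>2) \<longlonglongrightarrow>
            (\<Sum>n<N. (D2_weight \<gamma> n * cmod (c n - c n))\<^sup>2)"
        by (intro tendsto_intros c)
      hence "eventually (\<lambda>i. (\<Sum>n<N. (D2_weight \<gamma> n * cmod (taylor_coeff (\<sigma> (r i)) n - c n))\<^sup>2) < \<delta>) sequentially"
        using \<delta> by (intro order_tendstoD) auto
      then obtain I where I: "\<And>i. i \<ge> I \<Longrightarrow> (\<Sum>n<N. (D2_weight \<gamma> n * cmod (taylor_coeff (\<sigma> (r i)) n - c n))\<^sup>2) < \<delta>"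
        by (auto simp: eventually_sequentially)
      have "D2_dist \<gamma> (\<sigma> (r i)) (\<sigma> (r j)) < \<epsilon>" if ij: "i \<ge> I" "j \<ge> I" for i j
      proof -
        let ?F = "\<lambda>n. (D2_weight \<gamma> n * cmod (taylor_coeff (\<sigma> (r i)) n - taylor_coeff (\<sigma> (r j)) n))\<^sup>2"
        have "(\<Sum>n<K. ?F n) \<le> (3 * \<epsilon> / 4)\<^sup>2" for K
        proof -
          have "(\<Sum>n<K. ?F n) \<le> (\<Sum>n<N + K. ?F n)"
            by (intro sum_mono2) auto
          also have "\<dots> = (\<Sum>n<N. ?F n) + (\<Sum>n=N..<N + K. ?F n)"
            by (simp add: lessThan_atLeast0 sum.atLeastLessThan_concat)
          also have "(\<Sum>n<N. ?F n) \<le> 2 * (\<Sum>n<N. (D2_weight \<gamma> n * cmod (taylor_coeff (\<sigma> (r i)) n - c n))\<^sup>2) +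
              2 * (\<Sum>n<N. (D2_weight \<gamma> n * cmod (taylor_coeff (\<sigma> (r j)) n - c n))\<^sup>2)"
            unfolding sum_distrib_left sum.distrib[symmetric] by (intro sum_mono square_mult_triangle)
          also have "\<dots> \<le> 4 * \<delta>" using I[OF ij(1)] I[OF ij(2)] by linarith
          also have "(\<Sum>n=N..<N + K. ?F n) \<le> 2 * (\<Sum>n=N..<N + K. (D2_weight \<gamma> n * cmod (taylor_coeff (\<sigma> (r i)) n - 0))\<^sup>2) +
              2 * (\<Sum>n=N..<N + K. (D2_weight \<gamma> n * cmod (taylor_coeff (\<sigma> (r j)) n - 0))\<^sup>2)"
            unfolding sum_distrib_left sum.distrib[symmetric] by (intro sum_mono square_mult_triangle)
          also have "\<dots> \<le> 4 * \<delta>" using N[OF \<sigma>, of "r i" "N + K"] N[OF \<sigma>, of "r j" "N + K"] by simp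
          also have "4 * \<delta> + 4 * \<delta> \<le> (3 * \<epsilon> / 4)\<^sup>2" by (simp add: \<delta>_def power2_eq_square)
          finally show ?thesis by simp
        qed
        hence "D2_dist \<gamma> (\<sigma> (r i)) (\<sigma> (r j)) \<le> 3 * \<epsilon> / 4"
          using \<epsilon> by (intro D2_dist_le D) auto
        thus ?thesis using \<epsilon> by simp
      qed
      thus "\<exists>N. \<forall>i j. N \<le> i \<longrightarrow> N \<le> j \<longrightarrow> D2_dist \<gamma> ((\<sigma> \<circ> r) i) ((\<sigma> \<circ> r) j) < \<epsilon>"
        by auto
    qed
    with r show "\<exists>r. strict_mono r \<and> MCauchy (\<sigma> \<circ> r)" by blast
  qed
qed

text \<open>The finitely many centres of a net of radius \<open>sqrt (\<epsilon> / 4)\<close> have a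
  common small tail, and every element is near a centre. The tail may start at any m \<ge> N, so
  that it can later start at a power of 2.\<close>

lemma D2_mtotally_bounded_tail:
  assumes tb: "Metric_space.mtotally_bounded (D2 \<gamma>) (D2_dist \<gamma>) S" and \<epsilon>: "\<epsilon> > 0"
  shows "\<exists>N. \<forall>h\<in>S. \<forall>m\<ge>N. \<forall>M. (\<Sum>n=m..<M. (D2_weight \<gamma> n * cmod (taylor_coeff h n))\<^sup>2) \<le> \<epsilon>"
proof -
  interpret Metric_space "D2 \<gamma>" "D2_dist \<gamma>" by (rule Metric_space_D2)
  have pos: "sqrt (\<epsilon> / 4) > 0" using \<epsilon> by simp
  obtain F where F: "finite F" "F \<subseteq> S" "S \<subseteq> (\<Union>x\<in>F. mball x (sqrt (\<epsilon> / 4)))"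
    using tb[unfolded mtotally_bounded_def, rule_format, OF pos] by (elim exE conjE)
  have "\<exists>N. \<forall>m\<ge>N. \<forall>M. (\<Sum>n=m..<M. (D2_weight \<gamma> n * cmod (taylor_coeff h n))\<^sup>2) < \<epsilon> / 4" if "h \<in> F" for h
  proof -
    have "h \<in> D2 \<gamma>" using that F tb mtotally_bounded_imp_subset by blast
    from D2_summable[OF this, unfolded summable_Cauchy, rule_format, of "\<epsilon> / 4"] \<epsilon> show ?thesis
      by (simp add: sum_nonneg)
  qed
  hence "\<forall>h\<in>F. eventually (\<lambda>m. \<forall>M. (\<Sum>n=m..<M. (D2_weight \<gamma> n * cmod (taylor_coeff h n))\<^sup>2) < \<epsilon> / 4) sequentially"
    unfolding eventually_sequentially by blast
  hence "eventually (\<lambda>m. \<forall>h\<in>F. \<forall>M. (\<Sum>n=m..<M. (D2_weight \<gamma> n * cmod (taylor_coeff h n))\<^sup>2) < \<epsilon> / 4) sequentially"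
    using F(1) by (intro eventually_ball_finite)
  then obtain N where N: "\<And>m h M. m \<ge> N \<Longrightarrow> h \<in> F \<Longrightarrow> (\<Sum>n=m..<M. (D2_weight \<gamma> n * cmod (taylor_coeff h n))\<^sup>2) < \<epsilon> / 4"
    unfolding eventually_sequentially by blast
  have "(\<Sum>n=m..<M. (D2_weight \<gamma> n * cmod (taylor_coeff h n))\<^sup>2) \<le> \<epsilon>" if h: "h \<in> S" and m: "m \<ge> N" for h m M
  proof -
    obtain k where k: "k \<in> F" "h \<in> mball k (sqrt (\<epsilon> / 4))" using F h by blast
    hence D: "k \<in> D2 \<gamma>" "h \<in> D2 \<gamma>" and "D2_dist \<gamma> k h < sqrt (\<epsilon> / 4)" by auto
    hence "(D2_dist \<gamma> k h)\<^sup>2 \<le> (sqrt (\<epsilon> / 4))\<^sup>2" by (intro power_mono) auto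
    hence dist: "(D2_dist \<gamma> k h)\<^sup>2 \<le> \<epsilon> / 4" using \<epsilon> by simp
    have "(\<Sum>n=m..<M. (D2_weight \<gamma> n * cmod (taylor_coeff h n - 0))\<^sup>2) \<le>
       2 * (\<Sum>n=m..<M. (D2_weight \<gamma> n * cmod (taylor_coeff h n - taylor_coeff k n))\<^sup>2) +
       2 * (\<Sum>n=m..<M. (D2_weight \<gamma> n * cmod (0 - taylor_coeff k n))\<^sup>2)"
      unfolding sum_distrib_left sum.distrib[symmetric] by (intro sum_mono square_mult_triangle)
    also have "\<dots> \<le> 2 * (\<epsilon> / 4) + 2 * (\<epsilon> / 4)"
      using D2_partial_sum_le_dist[OF D(2,1), of "{m..<M}"] dist N[OF m k(1), of M]
      by (intro add_mono) (auto simp: commute)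
    finally show ?thesis by simp
  qed
  thus ?thesis by blast
qed

section \<open>Taylor coefficients of the generalized Hilbert operator\<close>

text \<open>Termwise integration under absolute convergence, transferred to a set by multiplying
  with its indicator.\<close>

lemma
  fixes u :: "nat \<Rightarrow> 'a \<Rightarrow> 'b :: {banach, second_countable_topology}"
  assumes int: "\<And>k. set_integrable M A (u k)"
    and abs: "\<And>x. x \<in> A \<Longrightarrow> summable (\<lambda>k. norm (u k x))"
    and F: "\<And>x. x \<in> A \<Longrightarrow> (\<lambda>k. u k x) sums F x"
    and sm: "summable (\<lambda>k. LINT x:A|M. norm (u k x))"
  shows set_integrable_series: "set_integrable M A F"
    and set_integral_sums: "(\<lambda>k. LINT x:A|M. u k x) sums (LINT x:A|M. F x)"
proof -
  let ?u = "\<lambda>k x. indicator A x *\<^sub>R u k x"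
  have eq: "(\<Sum>k. ?u k x) = indicator A x *\<^sub>R F x" for x
    using F[of x] by (cases "x \<in> A") (auto simp: sums_iff)
  have 1: "integrable M (?u k)" for k using int by (simp add: set_integrable_def)
  have 2: "AE x in M. summable (\<lambda>k. norm (?u k x))"
    using abs by (intro AE_I2) (auto simp: indicator_def)
  have 3: "summable (\<lambda>k. LINT x|M. norm (?u k x))"
    using sm by (simp add: set_lebesgue_integral_def)
  show "set_integrable M A F"
    using integrable_suminf[OF 1 2 3] by (simp add: eq set_integrable_def)
  show "(\<lambda>k. LINT x:A|M. u k x) sums (LINT x:A|M. F x)"
    using sums_integral[OF 1 2 3] by (simp add: eq set_lebesgue_integral_def)
qed

lemma
  shows set_integrable_power_unit: "set_integrable lborel {0..<1::real} (\<lambda>t. t ^ m)"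
    and set_integral_power_unit: "(LINT t:{0..<1::real}|lborel. t ^ m) = 1 / real (Suc m)"
proof -
  have "set_integrable lborel {0..1::real} (\<lambda>t. t ^ m)"
    by (intro borel_integrable_atLeastAtMost' continuous_intros)
  thus "set_integrable lborel {0..<1::real} (\<lambda>t. t ^ m)"
    by (rule set_integrable_subset) auto
  have "(LINT t:{0..<1::real}|lborel. t ^ m) = (LINT t:{0..1::real}|lborel. t ^ m)"
    by (rule set_integral_discrete_difference[where X = "{1}"]) auto
  also have "\<dots> = 1 / real (Suc m)"
    using integral_power[of 0 1 m] by (simp add: set_lebesgue_integral_def mult.commute)
  finally show "(LINT t:{0..<1::real}|lborel. t ^ m) = 1 / real (Suc m)" .
qed

lemma
  fixes c :: complex
  shows set_integrable_monomial_unit: "set_integrable lborel {0..<1::real} (\<lambda>t. c * of_real t ^ m)"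
    and set_integral_monomial_unit: "(LINT t:{0..<1::real}|lborel. c * of_real t ^ m) = c / of_nat (Suc m)"
proof -
  have "set_integrable lborel {0..<1::real} (\<lambda>t. complex_of_real (t ^ m))"
    using set_integrable_power_unit[of m] integrable_of_real[of lborel "\<lambda>t. indicator {0..<1} t *\<^sub>R t ^ m", where 'a = complex]
    by (simp add: set_integrable_def scaleR_conv_of_real)
  thus "set_integrable lborel {0..<1::real} (\<lambda>t. c * of_real t ^ m)" by simp
  have "(LINT t:{0..<1::real}|lborel. complex_of_real (t ^ m)) = of_real (1 / real (Suc m))"
    unfolding set_integral_complex_of_real set_integral_power_unit ..
  thus "(LINT t:{0..<1::real}|lborel. c * of_real t ^ m) = c / of_nat (Suc m)"
    by simp
qed

section \<open>Moments and the power series of the image\<close>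

text \<open>The n-th moment of f on [0,1), that is, the integral of \<open>f t * t ^ n\<close>, in
  series form; \<open>set_integral_moment\<close> proves the agreement.\<close>

definition moment :: "(complex \<Rightarrow> complex) \<Rightarrow> nat \<Rightarrow> complex" where
  "moment f n = (\<Sum>k. taylor_coeff f k / of_nat (n + Suc k))"

text \<open>The moments for the coefficients replaced by their absolute values: a majorant of the
  moments that decreases in n.\<close>

definition abs_moment :: "(complex \<Rightarrow> complex) \<Rightarrow> nat \<Rightarrow> real" where
  "abs_moment f n = (\<Sum>k. cmod (taylor_coeff f k) / real (n + Suc k))"

text \<open>The Taylor series of f is integrated termwise; the integrals of the absolute values of
  its terms are exactly the terms of the series assumed summable.\<close>

lemma
  assumes f: "f holomorphic_on ball 0 1"
    and sm: "summable (\<lambda>k. cmod (taylor_coeff f k) / real (n + Suc k))"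
  shows set_integrable_moment: "set_integrable lborel {0..<1} (\<lambda>t. f (of_real t) * of_real t ^ n)"
    and set_integral_moment: "(LINT t:{0..<1}|lborel. f (of_real t) * of_real t ^ n) = moment f n"
proof -
  define u :: "nat \<Rightarrow> real \<Rightarrow> complex" where "u = (\<lambda>k t. taylor_coeff f k * of_real t ^ (n + k))"
  have 1: "set_integrable lborel {0..<1} (u k)" for k
    unfolding u_def by (rule set_integrable_monomial_unit)
  have 2: "(\<lambda>k. u k t) sums (f (of_real t) * of_real t ^ n)" if "t \<in> {0..<1}" for t :: real
    using sums_mult2[OF taylor_sums_on_disc[OF f, of "of_real t"], of "of_real t ^ n"] that
    by (simp add: u_def power_add mult_ac)
  have 3: "summable (\<lambda>k. norm (u k t))" if t: "t \<in> {0..<1}" for t :: real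
  proof -
    \<comment> \<open>Convergence at a point strictly between t and 1 gives absolute convergence at
      t.\<close>
    have "(1 + t) / 2 < 1" "t < (1 + t) / 2" using t by auto
    hence "summable (\<lambda>k. norm (taylor_coeff f k * of_real t ^ k))"
      using t sums_summable[OF taylor_sums_on_disc[OF f, of "of_real ((1 + t) / 2)"]]
      by (intro powser_insidea[of _ "of_real ((1 + t) / 2)"]) (auto simp del: of_real_add of_real_divide)
    moreover have "norm (u k t) = t ^ n * norm (taylor_coeff f k * of_real t ^ k)" for k
      using t by (simp add: u_def power_add norm_mult norm_power)
    ultimately show ?thesis by (simp only: summable_mult)
  qed
  have 4: "(LINT t:{0..<1}|lborel. norm (u k t)) = cmod (taylor_coeff f k) / real (n + Suc k)" for k
  proof -
    have "(LINT t:{0..<1}|lborel. norm (u k t)) = (LINT t:{0..<1}|lborel. cmod (taylor_coeff f k) * t ^ (n + k))"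
      by (rule set_lebesgue_integral_cong) (auto simp: u_def norm_mult norm_power)
    thus ?thesis by (simp add: set_integral_power_unit)
  qed
  show "set_integrable lborel {0..<1} (\<lambda>t. f (of_real t) * of_real t ^ n)"
    by (rule set_integrable_series[OF 1 3 2]) (use sm in \<open>simp_all add: 4\<close>)
  have "(\<lambda>k. LINT t:{0..<1}|lborel. u k t) sums (LINT t:{0..<1}|lborel. f (of_real t) * of_real t ^ n)"
    by (rule set_integral_sums[OF 1 3 2]) (use sm in \<open>simp_all add: 4\<close>)
  moreover have "(LINT t:{0..<1}|lborel. u k t) = taylor_coeff f k / of_nat (n + Suc k)" for k
    unfolding u_def set_integral_monomial_unit by simp
  ultimately show "(LINT t:{0..<1}|lborel. f (of_real t) * of_real t ^ n) = moment f n"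
    by (simp add: moment_def sums_iff)
qed

lemma taylor_coeff_deriv:
  "taylor_coeff (deriv g) n = of_nat (Suc n) * taylor_coeff g (Suc n)"
  by (simp add: fps_expansion_def funpow_swap1 field_simps del: of_nat_Suc)

text \<open>Expanding \<open>deriv g\<close> at \<open>t * z\<close> and integrating termwise leaves
  the moments of f. The interchange holds since the series of \<open>deriv g\<close> converges
  absolutely at z, f is absolutely integrable on [0,1), and the powers of t are at most 1.\<close>

lemma gen_hilbert_sums:
  assumes g: "g holomorphic_on ball 0 1" and f: "f holomorphic_on ball 0 1"
    and sm: "\<And>n. summable (\<lambda>k. cmod (taylor_coeff f k) / real (n + Suc k))"
    and z: "z \<in> ball 0 1"
  shows "(\<lambda>n. (of_nat (Suc n) * taylor_coeff g (Suc n) * moment f n) * z ^ n) sums gen_hilbert g f z"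
proof -
  let ?c = "taylor_coeff (deriv g)"
  have g': "deriv g holomorphic_on ball 0 1" using g by (intro holomorphic_deriv) auto
  have int: "set_integrable lborel {0..<1} (\<lambda>t. f (of_real t) * of_real t ^ n)" for n
    by (rule set_integrable_moment[OF f sm])
  have abs: "summable (\<lambda>n. norm (?c n * z ^ n))"
  proof -
    define \<rho> where "\<rho> = (1 + cmod z) / 2"
    have \<rho>: "cmod z < \<rho>" "0 \<le> \<rho>" "\<rho> < 1" using z by (auto simp: \<rho>_def)
    show ?thesis
      by (rule powser_insidea[of _ "of_real \<rho>"])
         (use \<rho> sums_summable[OF taylor_sums_on_disc[OF g', of "of_real \<rho>"]] in auto)
  qed
  define u :: "nat \<Rightarrow> real \<Rightarrow> complex"
    where "u = (\<lambda>n t. (?c n * z ^ n) * (f (of_real t) * of_real t ^ n))"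
  have 1: "set_integrable lborel {0..<1} (u k)" for k
    unfolding u_def using int[of k] by simp
  have 2: "(\<lambda>n. u n t) sums (f (of_real t) * deriv g (of_real t * z))" if t: "t \<in> {0..<1}" for t :: real
  proof -
    have "cmod (of_real t * z) \<le> 1 * cmod z" unfolding norm_mult using t by (intro mult_right_mono) auto
    hence "of_real t * z \<in> ball 0 1" using z by simp
    from sums_mult[OF taylor_sums_on_disc[OF g' this], of "f (of_real t)"] show ?thesis
      by (simp add: u_def power_mult_distrib mult_ac)
  qed
  have le: "norm (u n t) \<le> norm (?c n * z ^ n) * norm (f (of_real t))" if t: "t \<in> {0..<1}" for t :: real and n
  proof -
    have "norm (f (of_real t) * of_real t ^ n) \<le> norm (f (of_real t)) * 1"
      unfolding norm_mult norm_power using t by (intro mult_left_mono power_le_one) auto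
    thus ?thesis unfolding u_def by (subst norm_mult) (intro mult_left_mono, auto)
  qed
  have 3: "summable (\<lambda>k. norm (u k t))" if t: "t \<in> {0..<1}" for t :: real
    by (rule summable_comparison_test'[OF summable_mult2[OF abs, of "norm (f (of_real t))"]])
       (use le[OF t] in auto)
  \<comment> \<open>The zeroth moment provides the absolute integrability of f.\<close>
  have intf: "set_integrable lborel {0..<1} (\<lambda>t::real. norm (f (of_real t)))"
    using set_integrable_norm[OF int[of 0]] by simp
  have 4: "summable (\<lambda>n. LINT t:{0..<1}|lborel. norm (u n t))"
  proof (rule summable_comparison_test'[OF summable_mult2[OF abs, of "LINT t:{0..<1::real}|lborel. norm (f (of_real t))"]])
    fix n
    have "(LINT t:{0..<1}|lborel. norm (u n t)) \<le>
        (LINT t:{0..<1::real}|lborel. norm (?c n * z ^ n) * norm (f (of_real t)))"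
      by (intro set_integral_mono set_integrable_norm 1 set_integrable_mult_right intf le)
    moreover have "0 \<le> (LINT t:{0..<1}|lborel. norm (u n t))"
      by (simp add: set_lebesgue_integral_def)
    ultimately show "norm (LINT t:{0..<1}|lborel. norm (u n t)) \<le>
        norm (?c n * z ^ n) * (LINT t:{0..<1::real}|lborel. norm (f (of_real t)))"
      by simp
  qed
  have "(\<lambda>n. LINT t:{0..<1}|lborel. u n t) sums (LINT t:{0..<1}|lborel. f (of_real t) * deriv g (of_real t * z))"
    by (rule set_integral_sums[OF 1 3 2 4])
  moreover have "(LINT t:{0..<1}|lborel. u n t) = (of_nat (Suc n) * taylor_coeff g (Suc n) * moment f n) * z ^ n" for n
    unfolding u_def set_integral_mult_right taylor_coeff_deriv
    by (simp add: set_integral_moment[OF f sm] mult_ac del: of_nat_Suc)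
  moreover have "gen_hilbert g f z = (LINT t:{0..<1}|lborel. f (of_real t) * deriv g (of_real t * z))"
    using z by (simp add: gen_hilbert_def)
  ultimately show ?thesis by simp
qed

section \<open>Norm estimates on dyadic blocks\<close>

lemma powr_comparable:
  fixes x y p :: real
  assumes "0 < x" "0 < y" "x \<le> 2 * y" "y \<le> 2 * x"
  shows "x powr p \<le> 2 powr \<bar>p\<bar> * y powr p"
proof (cases "p \<ge> 0")
  case True
  hence "x powr p \<le> (2 * y) powr p" using assms by (intro powr_mono2) auto
  thus ?thesis using True assms by (simp add: powr_mult)
next
  case False
  hence "x powr p \<le> (y / 2) powr p" using assms by (intro powr_mono2') auto
  also have "(y / 2) powr p = 2 powr - p * y powr p"
    using assms by (simp add: powr_divide powr_minus_divide)
  also have "- p = \<bar>p\<bar>" using False by simp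
  finally show ?thesis .
qed

lemma
  shows zero_in_D2 [simp]: "(\<lambda>_. 0) \<in> D2 \<gamma>"
    and taylor_coeff_zero [simp]: "taylor_coeff (\<lambda>_. 0) n = 0"
proof -
  have sums: "(\<lambda>n. 0 * z ^ n) sums 0" for z :: complex by simp
  note z = power_series_on_disc[where c = "\<lambda>_. 0", OF sums]
  show "taylor_coeff (\<lambda>_. 0) n = 0" by (rule z(2))
  thus "(\<lambda>_. 0) \<in> D2 \<gamma>" by (simp add: D2_iff_seq D2_seq_eq z(2))
qed

text \<open>The norm, written as a distance to 0 so that the coefficient estimates for distances
  apply to it directly.\<close>

abbreviation D2_size :: "real \<Rightarrow> (complex \<Rightarrow> complex) \<Rightarrow> real" where
  "D2_size \<gamma> h \<equiv> D2_dist \<gamma> h (\<lambda>_. 0)"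

lemma D2_partial_sum_le_size:
  assumes "h \<in> D2 \<gamma>" "finite A"
  shows "(\<Sum>n\<in>A. (D2_weight \<gamma> n * cmod (taylor_coeff h n))\<^sup>2) \<le> (D2_size \<gamma> h)\<^sup>2"
  using D2_partial_sum_le_dist[OF assms(1) zero_in_D2 assms(2)] by simp

text \<open>The dyadic inequality with s = 1 - \<alpha>/2, for which 2s - 1 is the weight exponent 1
  - \<alpha> and 2s is 2 - \<alpha>. The range 0 < \<alpha> < 2 is precisely 0 < s < 1.\<close>

lemma D2_hilbert:
  assumes \<alpha>: "0 < \<alpha>" "\<alpha> < 2" and f: "f \<in> D2 \<alpha>"
  shows "summable (\<lambda>k. cmod (taylor_coeff f k) / real (n + Suc k))"
    and "(\<Sum>N<L. 2 powr (real N * (2 - \<alpha>)) * (abs_moment f (2 ^ N))\<^sup>2) \<le>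
           2 * hilbert_const (1 - \<alpha> / 2) * (D2_size \<alpha> f)\<^sup>2"
proof -
  define s where "s = 1 - \<alpha> / 2"
  have s: "0 < s" "s < 1" "2 * s - 1 = 1 - \<alpha>" "2 * s = 2 - \<alpha>" using \<alpha> by (auto simp: s_def)
  \<comment> \<open>The weight is shifted from k+1 to k; the factor 2 suffices because \<bar>1 -
    \<alpha>\<bar> < 1.\<close>
  have "real (Suc k) powr (1 - \<alpha>) \<le> 2 * (D2_weight \<alpha> k)\<^sup>2" for k
  proof (cases "k = 0")
    case False
    hence "real (Suc k) powr (1 - \<alpha>) \<le> 2 powr \<bar>1 - \<alpha>\<bar> * real k powr (1 - \<alpha>)"
      by (intro powr_comparable) auto
    also have "\<dots> \<le> 2 powr 1 * real k powr (1 - \<alpha>)"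
      using \<alpha> by (intro mult_right_mono powr_mono) auto
    finally show ?thesis using False by (simp add: D2_weight_square)
  qed (simp add: D2_weight_def)
  hence "(\<Sum>k<K. real (Suc k) powr (1 - \<alpha>) * (cmod (taylor_coeff f k))\<^sup>2) \<le>
      (\<Sum>k<K. 2 * (D2_weight \<alpha> k)\<^sup>2 * (cmod (taylor_coeff f k))\<^sup>2)" for K
    by (intro sum_mono mult_right_mono) auto
  also have "(\<Sum>k<K. 2 * (D2_weight \<alpha> k)\<^sup>2 * (cmod (taylor_coeff f k))\<^sup>2) \<le> 2 * (D2_size \<alpha> f)\<^sup>2" for K
    using D2_partial_sum_le_size[OF f, of "{..<K}"] by (simp add: power_mult_distrib mult_ac flip: sum_distrib_left)
  finally have Q: "(\<Sum>k<K. real (Suc k) powr (2 * s - 1) * (cmod (taylor_coeff f k))\<^sup>2) \<le> 2 * (D2_size \<alpha> f)\<^sup>2" for K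
    unfolding s(3) .
  show "summable (\<lambda>k. cmod (taylor_coeff f k) / real (n + Suc k))"
    by (rule dyadic_hilbert_ineq(1)[OF s(1,2) norm_ge_zero Q])
  from dyadic_hilbert_ineq(2)[OF s(1,2) norm_ge_zero Q, of L, unfolded s(4)]
  show "(\<Sum>N<L. 2 powr (real N * (2 - \<alpha>)) * (abs_moment f (2 ^ N))\<^sup>2) \<le>
           2 * hilbert_const (1 - \<alpha> / 2) * (D2_size \<alpha> f)\<^sup>2"
    by (simp only: abs_moment_def s_def mult_ac)
qed

context
  fixes f :: "complex \<Rightarrow> complex"
  assumes sm: "\<And>n. summable (\<lambda>k. cmod (taylor_coeff f k) / real (n + Suc k))"
begin

lemma abs_moment_nonneg: "0 \<le> abs_moment f n"
  unfolding abs_moment_def by (intro suminf_nonneg sm) auto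

lemma abs_moment_antimono: "m \<le> n \<Longrightarrow> abs_moment f n \<le> abs_moment f m"
  unfolding abs_moment_def by (intro suminf_le sm divide_left_mono) auto

lemma norm_moment_le: "cmod (moment f n) \<le> abs_moment f n"
proof -
  have eq: "norm (taylor_coeff f k / of_nat (n + Suc k)) = cmod (taylor_coeff f k) / real (n + Suc k)" for k
    by (simp only: norm_divide norm_of_nat)
  show ?thesis
    unfolding moment_def abs_moment_def eq[symmetric] by (rule summable_norm) (unfold eq, rule sm)
qed

text \<open>Index 0 lies in no dyadic block, so it is reached through index 1 =
  \<open>2 ^ 0\<close>.\<close>

lemma abs_moment_0_le: "abs_moment f 0 \<le> 2 * abs_moment f 1"
proof -
  have "cmod (taylor_coeff f k) / real (0 + Suc k) \<le> 2 * (cmod (taylor_coeff f k) / real (1 + Suc k))" for k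
  proof -
    have "cmod (taylor_coeff f k) / real (0 + Suc k) \<le> cmod (taylor_coeff f k) / (real (1 + Suc k) / 2)"
      by (intro divide_left_mono) auto
    thus ?thesis by (simp add: mult.commute)
  qed
  thus ?thesis unfolding abs_moment_def suminf_mult[OF sm, symmetric]
    by (intro suminf_le sm summable_mult)
qed

end

text \<open>The term N = 0 of the Hilbert inequality bounds \<open>abs_moment f 1\<close>, and
  monotonicity does the rest. It gives the bound on single coefficients that total boundedness asks
  for.\<close>

lemma norm_moment_le_size:
  assumes \<alpha>: "0 < \<alpha>" "\<alpha> < 2" and f: "f \<in> D2 \<alpha>"
  shows "cmod (moment f n) \<le> 2 * sqrt (2 * hilbert_const (1 - \<alpha> / 2)) * D2_size \<alpha> f"
proof -
  note sm = D2_hilbert(1)[OF \<alpha> f]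
  have "abs_moment f 1 \<le> sqrt (2 * hilbert_const (1 - \<alpha> / 2) * (D2_size \<alpha> f)\<^sup>2)"
    using D2_hilbert(2)[OF \<alpha> f, of 1] by (intro real_le_rsqrt) simp
  also have "\<dots> = sqrt (2 * hilbert_const (1 - \<alpha> / 2)) * D2_size \<alpha> f"
    using Metric_space.nonneg[OF Metric_space_D2] by (simp add: real_sqrt_mult)
  finally show ?thesis
    using norm_moment_le[OF sm, of n] abs_moment_antimono[OF sm, of 0 n] abs_moment_0_le[OF sm] by simp
qed

section \<open>Tails of the image, block by block\<close>

text \<open>On the N-th block n is within a factor 2 of \<open>2 ^ N\<close>, so the weight is
  constant there up to a fixed factor.\<close>

lemma D2_weight_dyadic:
  assumes "2 ^ N \<le> n" "n < 2 ^ Suc N"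
  shows "(D2_weight \<gamma> n)\<^sup>2 \<le> 2 powr \<bar>1 - \<gamma>\<bar> * 2 powr (real N * (1 - \<gamma>))"
    and "2 powr (real N * (1 - \<gamma>)) \<le> 2 powr \<bar>1 - \<gamma>\<bar> * (D2_weight \<gamma> n)\<^sup>2"
proof -
  have n: "(2::real) ^ N \<le> real n" "real n \<le> 2 * 2 ^ N"
    using of_nat_mono[OF assms(1), where 'a = real] of_nat_mono[OF less_imp_le[OF assms(2)], where 'a = real]
    by simp_all
  have "(0::real) < 2 ^ N" by simp
  hence pos: "0 < real n" using n by linarith
  hence n': "(2::real) ^ N \<le> 2 * real n" using n by linarith
  show "(D2_weight \<gamma> n)\<^sup>2 \<le> 2 powr \<bar>1 - \<gamma>\<bar> * 2 powr (real N * (1 - \<gamma>))"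
    using n n' pos by (simp add: D2_weight_square two_powr_nat_mult powr_comparable)
  show "2 powr (real N * (1 - \<gamma>)) \<le> 2 powr \<bar>1 - \<gamma>\<bar> * (D2_weight \<gamma> n)\<^sup>2"
    using n n' pos by (simp add: D2_weight_square two_powr_nat_mult powr_comparable)
qed

lemma two_powr_nat_power2: "2 powr (real N * (p + 2)) = 2 powr (real N * p) * (2 ^ N :: real)\<^sup>2"
  by (simp add: two_powr_nat_mult powr_add)

lemma sum_dyadic_blocks:
  fixes F :: "nat \<Rightarrow> real"
  assumes "N0 \<le> L"
  shows "(\<Sum>n=2 ^ N0..<2 ^ L. F n) = (\<Sum>N=N0..<L. \<Sum>n=2 ^ N..<2 ^ Suc N. F n)"
  using assms
proof (induction L rule: dec_induct)
  case (step L)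
  have "(\<Sum>n=2 ^ N0..<2 ^ Suc L. F n) = (\<Sum>n=2 ^ N0..<2 ^ L. F n) + (\<Sum>n=2 ^ L..<2 ^ Suc L. F n)"
    by (rule sum.atLeastLessThan_concat[symmetric]) (use step in \<open>auto intro: power_increasing\<close>)
  thus ?case using step by simp
qed simp

text \<open>On the N-th block the weight and \<open>(Suc n)\<^sup>2\<close> give the exponent 3 -
  \<beta>, the coefficients of g give \<beta> - \<alpha> - 1, and the moments are at most
  \<open>abs_moment f (2 ^ N)\<close>. The exponents add up to 2 - \<alpha>, as in
  \<open>D2_hilbert\<close>. With a large \<epsilon> and \<open>N0 = 0\<close> this shows that the
  image lies in \<open>D2 \<beta>\<close>; with a small \<epsilon> it shows small tails.\<close>

lemma gen_hilbert_tail_le: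
  assumes \<alpha>: "0 < \<alpha>" "\<alpha> < 2" and f: "f \<in> D2 \<alpha>"
    and S: "\<And>N. N \<ge> N0 \<Longrightarrow> (\<Sum>n=2 ^ N..<2 ^ Suc N. (cmod (b (Suc n)))\<^sup>2) \<le> \<epsilon> * 2 powr (real N * (\<beta> - \<alpha> - 1))"
    and \<epsilon>: "\<epsilon> \<ge> 0"
  shows "(\<Sum>n=2 ^ N0..<M. (D2_weight \<beta> n * cmod (of_nat (Suc n) * b (Suc n) * moment f n))\<^sup>2) \<le>
           4 * 2 powr \<bar>1 - \<beta>\<bar> * \<epsilon> * (2 * hilbert_const (1 - \<alpha> / 2) * (D2_size \<alpha> f)\<^sup>2)"
proof -
  let ?F = "\<lambda>n. (D2_weight \<beta> n * cmod (of_nat (Suc n) * b (Suc n) * moment f n))\<^sup>2"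
  \<comment> \<open>The 4 comes from n+1 \<le> \<open>2 * 2 ^ N\<close>, squared; the power of 2 is
    the variation of the weight on a block.\<close>
  define C where "C = 4 * 2 powr \<bar>1 - \<beta>\<bar>"
  have C: "C \<ge> 0" by (simp add: C_def)
  note sm = D2_hilbert(1)[OF \<alpha> f]
  have block: "(\<Sum>n=2 ^ N..<2 ^ Suc N. ?F n) \<le> C * \<epsilon> * (2 powr (real N * (2 - \<alpha>)) * (abs_moment f (2 ^ N))\<^sup>2)"
    if N: "N \<ge> N0" for N
  proof -
    let ?P = "2 powr (real N * (3 - \<beta>))"
    have "?F n \<le> C * ?P * (abs_moment f (2 ^ N))\<^sup>2 * (cmod (b (Suc n)))\<^sup>2" if n: "n \<in> {2 ^ N..<2 ^ Suc N}" for n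
    proof -
      have "real (Suc n) \<le> real (2 ^ Suc N)" using n by (intro of_nat_mono) auto
      hence "(real (Suc n))\<^sup>2 \<le> (2 * 2 ^ N)\<^sup>2" by (intro power_mono) (auto simp: mult.commute)
      hence "(D2_weight \<beta> n)\<^sup>2 * (real (Suc n))\<^sup>2 \<le> 2 powr \<bar>1 - \<beta>\<bar> * 2 powr (real N * (1 - \<beta>)) * (2 * 2 ^ N)\<^sup>2"
        using n by (intro mult_mono D2_weight_dyadic) auto
      also have "\<dots> = C * ?P"
        using two_powr_nat_power2[of N "1 - \<beta>"] by (simp add: C_def power_mult_distrib)
      finally have 1: "(D2_weight \<beta> n)\<^sup>2 * (real (Suc n))\<^sup>2 \<le> C * ?P" .
      have "cmod (moment f n) \<le> abs_moment f (2 ^ N)"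
        using norm_moment_le[OF sm, of n] abs_moment_antimono[OF sm, of "2 ^ N" n] n by simp
      hence 2: "(cmod (moment f n))\<^sup>2 \<le> (abs_moment f (2 ^ N))\<^sup>2" by (intro power_mono) auto
      have "?F n = ((D2_weight \<beta> n)\<^sup>2 * (real (Suc n))\<^sup>2) * (cmod (moment f n))\<^sup>2 * (cmod (b (Suc n)))\<^sup>2"
        by (simp only: norm_mult norm_of_nat power_mult_distrib mult_ac)
      also have "\<dots> \<le> C * ?P * (abs_moment f (2 ^ N))\<^sup>2 * (cmod (b (Suc n)))\<^sup>2"
        by (intro mult_right_mono mult_mono[OF 1 2]) (use C in auto)
      finally show ?thesis .
    qed
    hence "(\<Sum>n=2 ^ N..<2 ^ Suc N. ?F n) \<le>
       (\<Sum>n=2 ^ N..<2 ^ Suc N. C * ?P * (abs_moment f (2 ^ N))\<^sup>2 * (cmod (b (Suc n)))\<^sup>2)"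
      by (rule sum_mono)
    also have "\<dots> = C * ?P * (abs_moment f (2 ^ N))\<^sup>2 * (\<Sum>n=2 ^ N..<2 ^ Suc N. (cmod (b (Suc n)))\<^sup>2)"
      by (simp only: sum_distrib_left)
    also have "\<dots> \<le> C * ?P * (abs_moment f (2 ^ N))\<^sup>2 * (\<epsilon> * 2 powr (real N * (\<beta> - \<alpha> - 1)))"
      using C by (intro mult_left_mono S N) auto
    also have "\<dots> = C * \<epsilon> * ((?P * 2 powr (real N * (\<beta> - \<alpha> - 1))) * (abs_moment f (2 ^ N))\<^sup>2)"
      by (simp only: mult_ac)
    also have "?P * 2 powr (real N * (\<beta> - \<alpha> - 1)) = 2 powr (real N * (2 - \<alpha>))"
      by (simp add: algebra_simps flip: powr_add)
    finally show ?thesis .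
  qed
  \<comment> \<open>Chosen so that the blocks from \<open>N0\<close> up to \<open>L\<close> cover
    everything below \<open>M\<close>.\<close>
  define L where "L = max N0 M"
  have "M < 2 ^ M" by (rule less_exp)
  also have "\<dots> \<le> (2::nat) ^ L" by (intro power_increasing) (auto simp: L_def)
  finally have "(\<Sum>n=2 ^ N0..<M. ?F n) \<le> (\<Sum>n=2 ^ N0..<2 ^ L. ?F n)"
    by (intro sum_mono2) auto
  also have "\<dots> = (\<Sum>N=N0..<L. \<Sum>n=2 ^ N..<2 ^ Suc N. ?F n)"
    by (rule sum_dyadic_blocks) (simp add: L_def)
  also have "\<dots> \<le> (\<Sum>N=N0..<L. C * \<epsilon> * (2 powr (real N * (2 - \<alpha>)) * (abs_moment f (2 ^ N))\<^sup>2))"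
    by (intro sum_mono block) auto
  also have "\<dots> \<le> (\<Sum>N<L. C * \<epsilon> * (2 powr (real N * (2 - \<alpha>)) * (abs_moment f (2 ^ N))\<^sup>2))"
    using C \<epsilon> by (intro sum_mono2) auto
  also have "\<dots> \<le> C * \<epsilon> * (2 * hilbert_const (1 - \<alpha> / 2) * (D2_size \<alpha> f)\<^sup>2)"
    unfolding sum_distrib_left[symmetric] using C \<epsilon> by (intro mult_left_mono D2_hilbert(2)[OF \<alpha> f]) auto
  finally show ?thesis by (simp add: C_def)
qed

section \<open>Compactness\<close>

lemma
  assumes g: "g holomorphic_on ball 0 1" and \<alpha>: "0 < \<alpha>" "\<alpha> < 2" and f: "f \<in> D2 \<alpha>"
  shows gen_hilbert_holomorphic: "gen_hilbert g f holomorphic_on ball 0 1"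
    and taylor_coeff_gen_hilbert:
      "taylor_coeff (gen_hilbert g f) n = of_nat (Suc n) * taylor_coeff g (Suc n) * moment f n"
proof -
  have "f holomorphic_on ball 0 1" using f by (simp add: D2_def)
  note sums = gen_hilbert_sums[OF g this D2_hilbert(1)[OF \<alpha> f]]
  show "gen_hilbert g f holomorphic_on ball 0 1" by (rule power_series_on_disc(1)[OF sums])
  show "taylor_coeff (gen_hilbert g f) n = of_nat (Suc n) * taylor_coeff g (Suc n) * moment f n"
    by (rule power_series_on_disc(2)[OF sums])
qed

lemma gen_hilbert_in_D2:
  assumes g: "g holomorphic_on ball 0 1" and \<alpha>: "0 < \<alpha>" "\<alpha> < 2" and f: "f \<in> D2 \<alpha>"
    and S: "\<And>N. (\<Sum>n=2 ^ N..<2 ^ Suc N. (cmod (taylor_coeff g (Suc n)))\<^sup>2) \<le> B * 2 powr (real N * (\<beta> - \<alpha> - 1))"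
    and B: "B \<ge> 0"
  shows "gen_hilbert g f \<in> D2 \<beta>"
proof -
  let ?F = "\<lambda>n. (D2_weight \<beta> n * cmod (taylor_coeff (gen_hilbert g f) n))\<^sup>2"
  note coeff = taylor_coeff_gen_hilbert[OF g \<alpha> f]
  have "summable ?F"
  proof (rule summableI_nonneg_bounded)
    fix K
    \<comment> \<open>The blocks start at \<open>2 ^ 0 = 1\<close>, so the constant term is bounded
      apart.\<close>
    have "(\<Sum>n<K. ?F n) \<le> (\<Sum>n\<in>insert 0 {2 ^ 0..<K}. ?F n)"
      by (intro sum_mono2) auto
    also have "\<dots> = ?F 0 + (\<Sum>n=2 ^ 0..<K. ?F n)"
      by (rule sum.insert) auto
    also have "(\<Sum>n=2 ^ 0..<K. ?F n) \<le> 4 * 2 powr \<bar>1 - \<beta>\<bar> * B * (2 * hilbert_const (1 - \<alpha> / 2) * (D2_size \<alpha> f)\<^sup>2)"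
      unfolding coeff by (rule gen_hilbert_tail_le[OF \<alpha> f S B])
    finally show "(\<Sum>n<K. ?F n) \<le> ?F 0 + 4 * 2 powr \<bar>1 - \<beta>\<bar> * B * (2 * hilbert_const (1 - \<alpha> / 2) * (D2_size \<alpha> f)\<^sup>2)"
      by simp
  qed simp
  thus ?thesis
    using gen_hilbert_holomorphic[OF g \<alpha> f] by (simp add: D2_iff_seq D2_seq_eq gen_hilbert_def)
qed

section \<open>The little-o condition implies compactness\<close>

text \<open>Images of bounded sets have bounded coefficients and uniformly small tails, hence are
  totally bounded; completeness of \<open>D2 \<beta>\<close> makes their closures compact.\<close>

lemma compact_gen_hilbert:
  assumes g: "g holomorphic_on ball 0 1" and \<alpha>: "0 < \<alpha>" "\<alpha> < 2"
    and lim: "(\<lambda>N. (\<Sum>n=2 ^ N..<2 ^ Suc N. (cmod (taylor_coeff g (Suc n)))\<^sup>2) /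
                2 powr (real N * (\<beta> - \<alpha> - 1))) \<longlonglongrightarrow> 0"
  shows "compact_operator (D2 \<alpha>) (D2_dist \<alpha>) (D2 \<beta>) (D2_dist \<beta>) (gen_hilbert g)"
proof -
  let ?S = "\<lambda>N. \<Sum>n=2 ^ N..<2 ^ Suc N. (cmod (taylor_coeff g (Suc n)))\<^sup>2"
  let ?q = "\<lambda>N. 2 powr (real N * (\<beta> - \<alpha> - 1))"
  interpret A: Metric_space "D2 \<alpha>" "D2_dist \<alpha>" by (rule Metric_space_D2)
  interpret B: Metric_space "D2 \<beta>" "D2_dist \<beta>" by (rule Metric_space_D2)
  \<comment> \<open>A convergent sequence is bounded; this big-O bound over all blocks already makes
    the operator map into \<open>D2 \<beta>\<close>.\<close>
  have "Bseq (\<lambda>N. ?S N / ?q N)" by (rule convergent_imp_Bseq[OF convergentI[OF lim]])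
  then obtain K where K: "K > 0" "\<And>N. norm (?S N / ?q N) \<le> K" by (auto simp: Bseq_def)
  have "?S N \<le> K * ?q N" for N
  proof -
    have "?S N / ?q N \<le> K" using K(2)[of N] by (simp only: real_norm_def)
    thus ?thesis by (simp only: pos_divide_le_eq powr_gt_zero)
  qed
  note in_D2 = gen_hilbert_in_D2[OF g \<alpha> _ this less_imp_le[OF K(1)]]
  have "compactin B.mtopology (B.mtopology closure_of (gen_hilbert g ` S))" if "A.mbounded S" for S
  proof -
    have SD: "S \<subseteq> D2 \<alpha>" using that by (rule A.mbounded_subset_mspace)
    \<comment> \<open>Adding 0 turns the bound on mutual distances into a bound on norms.\<close>
    have "A.mbounded (insert (\<lambda>_. 0) S)" using that by (simp add: A.mbounded_insert)
    then obtain R where "\<forall>x\<in>insert (\<lambda>_. 0) S. \<forall>y\<in>insert (\<lambda>_. 0) S. D2_dist \<alpha> x y \<le> R"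
      unfolding A.mbounded_alt by blast
    hence R: "D2_size \<alpha> f \<le> R" if "f \<in> S" for f using that by blast
    have "0 < hilbert_const (1 - \<alpha> / 2)" using \<alpha> by (intro hilbert_const_pos) auto
    note hc = less_imp_le[OF this]
    have "B.mtotally_bounded (gen_hilbert g ` S)"
    proof (rule D2_mtotally_boundedI)
      show "gen_hilbert g ` S \<subseteq> D2 \<beta>" using in_D2 SD by blast
      show "\<exists>C. \<forall>h\<in>gen_hilbert g ` S. cmod (taylor_coeff h n) \<le> C" for n
      proof (intro exI ballI)
        fix h assume "h \<in> gen_hilbert g ` S"
        then obtain f where f: "f \<in> S" "h = gen_hilbert g f" by blast
        hence fD: "f \<in> D2 \<alpha>" using SD by blast
        have "cmod (moment f n) \<le> 2 * sqrt (2 * hilbert_const (1 - \<alpha> / 2)) * R"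
          by (rule order_trans[OF norm_moment_le_size[OF \<alpha> fD]], rule mult_left_mono[OF R[OF f(1)]])
             (use hc in simp)
        thus "cmod (taylor_coeff h n) \<le> cmod (of_nat (Suc n) * taylor_coeff g (Suc n)) *
             (2 * sqrt (2 * hilbert_const (1 - \<alpha> / 2)) * R)"
          unfolding f(2) taylor_coeff_gen_hilbert[OF g \<alpha> fD] norm_mult[of _ "moment f n"]
          by (intro mult_left_mono) auto
      qed
      fix \<epsilon> :: real assume \<epsilon>: "\<epsilon> > 0"
      define C where "C = 4 * 2 powr \<bar>1 - \<beta>\<bar> * (2 * hilbert_const (1 - \<alpha> / 2) * R\<^sup>2)"
      have C: "C \<ge> 0" using hc by (simp add: C_def)
      \<comment> \<open>The denominator is C + 1 because C is 0 when R is 0.\<close>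
      define \<delta> where "\<delta> = \<epsilon> / (C + 1)"
      have \<delta>: "\<delta> > 0" using \<epsilon> C by (simp add: \<delta>_def)
      have "eventually (\<lambda>N. ?S N / ?q N < \<delta>) sequentially" by (rule order_tendstoD(2)[OF lim \<delta>])
      then obtain N0 where N0: "\<And>N. N \<ge> N0 \<Longrightarrow> ?S N / ?q N < \<delta>"
        unfolding eventually_sequentially by blast
      have S: "?S N \<le> \<delta> * ?q N" if "N \<ge> N0" for N
        using less_imp_le[OF N0[OF that]] by (simp only: pos_divide_le_eq powr_gt_zero)
      have "(\<Sum>n=2 ^ N0..<M. (D2_weight \<beta> n * cmod (taylor_coeff (gen_hilbert g f) n))\<^sup>2) \<le> \<epsilon>"
        if f: "f \<in> S" for f M
      proof -
        have fD: "f \<in> D2 \<alpha>" using f SD by blast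
        have "(\<Sum>n=2 ^ N0..<M. (D2_weight \<beta> n * cmod (taylor_coeff (gen_hilbert g f) n))\<^sup>2)
            \<le> 4 * 2 powr \<bar>1 - \<beta>\<bar> * \<delta> * (2 * hilbert_const (1 - \<alpha> / 2) * (D2_size \<alpha> f)\<^sup>2)"
          unfolding taylor_coeff_gen_hilbert[OF g \<alpha> fD]
          by (rule gen_hilbert_tail_le[OF \<alpha> fD S less_imp_le[OF \<delta>]])
        also have "\<dots> \<le> 4 * 2 powr \<bar>1 - \<beta>\<bar> * \<delta> * (2 * hilbert_const (1 - \<alpha> / 2) * R\<^sup>2)"
          using \<delta> hc R[OF f] by (intro mult_left_mono power_mono) auto
        also have "\<dots> = \<delta> * C" by (simp add: C_def)
        also have "\<dots> \<le> \<delta> * (C + 1)" using \<delta> by simp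
        also have "\<dots> = \<epsilon>" using C by (simp add: \<delta>_def)
        finally show ?thesis .
      qed
      thus "\<exists>N. \<forall>h\<in>gen_hilbert g ` S. \<forall>M. (\<Sum>n=N..<M. (D2_weight \<beta> n * cmod (taylor_coeff h n))\<^sup>2) \<le> \<epsilon>"
        by blast
    qed
    thus ?thesis using B.mtotally_bounded_eq_compact_closure_of[OF mcomplete_D2] by blast
  qed
  with in_D2 show ?thesis unfolding compact_operator_def by blast
qed

section \<open>Compactness implies the little-o condition\<close>

text \<open>Each of the \<open>2 ^ N\<close> indices of the block carries the same share
  \<open>2 powr - real N\<close> of the squared norm. The coefficients are nonnegative, so nothing
  cancels in the moments, and all denominators are at most \<open>4 * 2 ^ N\<close>.\<close>

lemma dyadic_test_function:
  assumes \<alpha>: "0 < \<alpha>" "\<alpha> < 2"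
  obtains f where "f \<in> D2 \<alpha>" "D2_size \<alpha> f \<le> 1"
    "\<And>n. n \<in> {2 ^ N..<2 ^ Suc N} \<Longrightarrow> 2 powr (real N * (\<alpha> - 2)) / 32 \<le> (cmod (moment f n))\<^sup>2"
proof -
  let ?I = "{2 ^ N..<2 ^ Suc N} :: nat set"
  define d where "d = 2 powr (- real N / 2)"
  define c where "c k = (if k \<in> ?I then d / D2_weight \<alpha> k else 0)" for k
  have d2: "d\<^sup>2 = 2 powr - real N" by (simp add: d_def power2_eq_square flip: powr_add)
  have wc: "(D2_weight \<alpha> k * cmod (of_real (c k)))\<^sup>2 = (if k \<in> ?I then 2 powr - real N else 0)" for k
    using D2_weight_pos[of \<alpha> k] by (auto simp: c_def d2 power_mult_distrib power_divide simp del: D2_weight_pos)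
  have "summable (\<lambda>k. (D2_weight \<alpha> k * cmod (of_real (c k)))\<^sup>2)"
    by (rule summable_finite[of ?I]) (auto simp: c_def)
  then obtain f where f: "f \<in> D2 \<alpha>" "\<And>k. taylor_coeff f k = of_real (c k)"
    using D2_of_coeffs[where c = "\<lambda>k. of_real (c k)"] by metis
  have size: "D2_size \<alpha> f \<le> 1"
  proof (rule D2_dist_le[OF f(1) zero_in_D2])
    fix K
    have "(\<Sum>k<K. (D2_weight \<alpha> k * cmod (taylor_coeff f k - taylor_coeff (\<lambda>_. 0) k))\<^sup>2) =
       (\<Sum>k<K. if k \<in> ?I then 2 powr - real N else 0)"
      unfolding taylor_coeff_zero diff_zero f(2) wc ..
    also have "\<dots> = (\<Sum>k\<in>{..<K} \<inter> ?I. 2 powr - real N)" by (rule sum.inter_restrict[symmetric]) simp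
    also have "\<dots> \<le> (\<Sum>k\<in>?I. 2 powr - real N)" by (intro sum_mono2) auto
    also have "\<dots> = 1\<^sup>2" by (simp add: powr_minus powr_realpow)
    finally show "(\<Sum>k<K. (D2_weight \<alpha> k * cmod (taylor_coeff f k - taylor_coeff (\<lambda>_. 0) k))\<^sup>2) \<le> 1\<^sup>2" .
  qed simp
  have mom: "2 powr (real N * (\<alpha> - 2)) / 32 \<le> (cmod (moment f n))\<^sup>2" if n: "n \<in> ?I" for n
  proof -
    \<comment> \<open>An upper bound for the weight on the block, hence d/v a lower bound for the
      coefficients. The final 32 is 4 squared times the 2 in \<open>v\<close>.\<close>
    define v where "v = sqrt (2 * 2 powr (real N * (1 - \<alpha>)))"
    have v: "v > 0" by (simp add: v_def)
    have w: "D2_weight \<alpha> k \<le> v" if "k \<in> ?I" for k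
    proof -
      have "(D2_weight \<alpha> k)\<^sup>2 \<le> 2 powr \<bar>1 - \<alpha>\<bar> * 2 powr (real N * (1 - \<alpha>))"
        using that by (intro D2_weight_dyadic) auto
      also have "\<dots> \<le> 2 powr 1 * 2 powr (real N * (1 - \<alpha>))"
        using \<alpha> by (intro mult_right_mono powr_mono) auto
      finally show ?thesis unfolding v_def by (intro real_le_rsqrt) simp
    qed
    have "moment f n = (\<Sum>k\<in>?I. taylor_coeff f k / of_nat (n + Suc k))"
      unfolding moment_def by (rule suminf_finite) (auto simp: f(2) c_def)
    also have "\<dots> = of_real (\<Sum>k\<in>?I. c k / real (n + Suc k))"
      by (simp add: f(2))
    finally have m: "cmod (moment f n) = \<bar>\<Sum>k\<in>?I. c k / real (n + Suc k)\<bar>"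
      by (simp only: norm_of_real)
    have "d / v / 4 = (\<Sum>k\<in>?I. d / v / (4 * 2 ^ N))" by simp
    also have "\<dots> \<le> (\<Sum>k\<in>?I. c k / real (n + Suc k))"
    proof (rule sum_mono)
      fix k assume k: "k \<in> ?I"
      have "n + Suc k \<le> 4 * 2 ^ N" using n k by auto
      hence "real (n + Suc k) \<le> real (4 * 2 ^ N)" by (rule of_nat_mono)
      hence nk: "real (n + Suc k) \<le> 4 * 2 ^ N" by simp
      have "d / v \<le> c k"
        using w[OF k] k v by (simp add: c_def d_def frac_le)
      moreover have "0 \<le> c k" by (simp add: c_def d_def)
      ultimately show "d / v / (4 * 2 ^ N) \<le> c k / real (n + Suc k)"
        using nk by (intro frac_le) auto
    qed
    finally have "d / v / 4 \<le> cmod (moment f n)" unfolding m by simp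
    hence "(d / v / 4)\<^sup>2 \<le> (cmod (moment f n))\<^sup>2"
      using v by (intro power_mono) (auto simp: d_def)
    also have "(d / v / 4)\<^sup>2 = 2 powr - real N / 2 powr (real N * (1 - \<alpha>)) / 32"
      by (simp add: power_divide d2 v_def)
    also have "2 powr - real N / 2 powr (real N * (1 - \<alpha>)) = 2 powr (real N * (\<alpha> - 2))"
      by (simp add: algebra_simps flip: powr_diff)
    finally show ?thesis .
  qed
  show ?thesis by (rule that[OF f(1) size mom])
qed

text \<open>The images of the test functions form a totally bounded set, so their tails are
  uniformly small. The N-th block of the N-th image dominates the normalized block sum, since (1 -
  \<beta>) + 2 + (\<alpha> - 2) = -(\<beta> - \<alpha> - 1).\<close>

lemma compact_gen_hilbert_imp:
  assumes g: "g holomorphic_on ball 0 1" and \<alpha>: "0 < \<alpha>" "\<alpha> < 2"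
    and comp: "compact_operator (D2 \<alpha>) (D2_dist \<alpha>) (D2 \<beta>) (D2_dist \<beta>) (gen_hilbert g)"
  shows "(\<lambda>N. (\<Sum>n=2 ^ N..<2 ^ Suc N. (cmod (taylor_coeff g (Suc n)))\<^sup>2) /
                2 powr (real N * (\<beta> - \<alpha> - 1))) \<longlonglongrightarrow> 0"
proof -
  let ?S = "\<lambda>N. \<Sum>n=2 ^ N..<2 ^ Suc N. (cmod (taylor_coeff g (Suc n)))\<^sup>2"
  interpret A: Metric_space "D2 \<alpha>" "D2_dist \<alpha>" by (rule Metric_space_D2)
  interpret B: Metric_space "D2 \<beta>" "D2_dist \<beta>" by (rule Metric_space_D2)
  have "\<forall>N. \<exists>f. f \<in> D2 \<alpha> \<and> D2_size \<alpha> f \<le> 1 \<and>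
    (\<forall>n\<in>{2 ^ N..<2 ^ Suc N}. 2 powr (real N * (\<alpha> - 2)) / 32 \<le> (cmod (moment f n))\<^sup>2)"
    using dyadic_test_function[OF \<alpha>] by metis
  then obtain f where f: "\<And>N. f N \<in> D2 \<alpha>" "\<And>N. D2_size \<alpha> (f N) \<le> 1"
    and mom: "\<And>N n. n \<in> {2 ^ N..<2 ^ Suc N} \<Longrightarrow> 2 powr (real N * (\<alpha> - 2)) / 32 \<le> (cmod (moment (f N) n))\<^sup>2"
    by metis
  have "range f \<subseteq> A.mcball (\<lambda>_. 0) 1" using f by (auto simp: A.commute[of "\<lambda>_. 0"])
  hence "A.mbounded (range f)" unfolding A.mbounded_def by blast
  hence "compactin B.mtopology (B.mtopology closure_of (gen_hilbert g ` range f))"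
    and "gen_hilbert g ` range f \<subseteq> D2 \<beta>"
    using comp f(1) unfolding compact_operator_def by blast+
  hence tb: "B.mtotally_bounded (gen_hilbert g ` range f)"
    by (intro B.compact_closure_of_imp_mtotally_bounded)
  \<comment> \<open>The 32 undoes the constant in the lower bound for the moments, the power of 2
    the variation of the weight on a block.\<close>
  define C where "C = 32 * 2 powr \<bar>1 - \<beta>\<bar>"
  have C: "C > 0" by (simp add: C_def)
  have lower: "?S N / 2 powr (real N * (\<beta> - \<alpha> - 1)) \<le>
      C * (\<Sum>n=2 ^ N..<2 ^ Suc N. (D2_weight \<beta> n * cmod (taylor_coeff (gen_hilbert g (f N)) n))\<^sup>2)" for N
    unfolding sum_distrib_left sum_divide_distrib
  proof (rule sum_mono)
    fix n :: nat assume n: "n \<in> {2 ^ N..<2 ^ Suc N}"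
    let ?b = "(cmod (taylor_coeff g (Suc n)))\<^sup>2"
    have 1: "2 powr (real N * (1 - \<beta>)) \<le> 2 powr \<bar>1 - \<beta>\<bar> * (D2_weight \<beta> n)\<^sup>2"
      using n by (intro D2_weight_dyadic) auto
    have "2 ^ N \<le> Suc n" using n by auto
    hence "real (2 ^ N) \<le> real (Suc n)" by (rule of_nat_mono)
    hence 2: "(2 ^ N :: real)\<^sup>2 \<le> (real (Suc n))\<^sup>2" by (intro power_mono) auto
    have "2 powr (real N * (1 - \<beta>)) * (2 ^ N)\<^sup>2 * (2 powr (real N * (\<alpha> - 2)) / 32) \<le>
        2 powr \<bar>1 - \<beta>\<bar> * (D2_weight \<beta> n)\<^sup>2 * (real (Suc n))\<^sup>2 * (cmod (moment (f N) n))\<^sup>2"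
      by (intro mult_mono[OF mult_mono[OF 1 2] mom[OF n]]) auto
    hence "2 powr (real N * (1 - \<beta>)) * (2 ^ N)\<^sup>2 * 2 powr (real N * (\<alpha> - 2)) \<le>
        C * ((D2_weight \<beta> n)\<^sup>2 * (real (Suc n))\<^sup>2 * (cmod (moment (f N) n))\<^sup>2)"
      by (simp only: C_def)
    also have "2 powr (real N * (1 - \<beta>)) * (2 ^ N)\<^sup>2 * 2 powr (real N * (\<alpha> - 2)) = inverse (2 powr (real N * (\<beta> - \<alpha> - 1)))"
      unfolding two_powr_nat_power2[symmetric] powr_minus[symmetric]
      by (simp add: algebra_simps flip: powr_add)
    finally have "?b * inverse (2 powr (real N * (\<beta> - \<alpha> - 1))) \<le>
       ?b * (C * ((D2_weight \<beta> n)\<^sup>2 * (real (Suc n))\<^sup>2 * (cmod (moment (f N) n))\<^sup>2))"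
      by (intro mult_left_mono) auto
    also have "\<dots> = C * (D2_weight \<beta> n * cmod (taylor_coeff (gen_hilbert g (f N)) n))\<^sup>2"
      unfolding taylor_coeff_gen_hilbert[OF g \<alpha> f(1)]
      by (simp only: norm_mult norm_of_nat power_mult_distrib mult_ac)
    finally show "?b / 2 powr (real N * (\<beta> - \<alpha> - 1)) \<le> C * (D2_weight \<beta> n * cmod (taylor_coeff (gen_hilbert g (f N)) n))\<^sup>2"
      by (simp only: divide_inverse)
  qed
  show ?thesis
  proof (rule LIMSEQ_I)
    fix \<epsilon> :: real assume \<epsilon>: "\<epsilon> > 0"
    hence "\<epsilon> / (2 * C) > 0" using C by simp
    from D2_mtotally_bounded_tail[OF tb this] obtain N0 where
      N0: "\<And>N m M. m \<ge> N0 \<Longrightarrow> (\<Sum>n=m..<M. (D2_weight \<beta> n * cmod (taylor_coeff (gen_hilbert g (f N)) n))\<^sup>2) \<le> \<epsilon> / (2 * C)"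
      by blast
    have "norm (?S N / 2 powr (real N * (\<beta> - \<alpha> - 1)) - 0) < \<epsilon>" if "N \<ge> N0" for N
    proof -
      \<comment> \<open>The N-th block starts at \<open>2 ^ N\<close> > N, hence lies in the tail
        from \<open>N0\<close> on.\<close>
      have "N0 \<le> 2 ^ N" using that less_exp[of N] by linarith
      have "?S N / 2 powr (real N * (\<beta> - \<alpha> - 1)) \<le> C * (\<epsilon> / (2 * C))"
        by (rule order_trans[OF lower mult_left_mono[OF N0]]) (use C \<open>N0 \<le> 2 ^ N\<close> in auto)
      also have "\<dots> < \<epsilon>" using C \<epsilon> by simp
      finally have "?S N / 2 powr (real N * (\<beta> - \<alpha> - 1)) < \<epsilon>" .
      moreover have "0 \<le> ?S N / 2 powr (real N * (\<beta> - \<alpha> - 1))" by (intro divide_nonneg_nonneg sum_nonneg) auto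
      ultimately show ?thesis by (simp only: real_norm_def diff_zero abs_of_nonneg)
    qed
    thus "\<exists>N0. \<forall>N\<ge>N0. norm (?S N / 2 powr (real N * (\<beta> - \<alpha> - 1)) - 0) < \<epsilon>" by blast
  qed
qed

theorem theorem2p3:
  fixes g :: "complex \<Rightarrow> complex" and b :: "nat \<Rightarrow> complex" and \<alpha> \<beta> :: real
  assumes "g holomorphic_on ball 0 1"
    and "\<And>z. z \<in> ball 0 1 \<Longrightarrow> (\<lambda>n. b n * z ^ n) sums g z"
    and "0 < \<alpha>" and "\<alpha> < 2"
  shows "compact_operator (D2 \<alpha>) (D2_dist \<alpha>) (D2 \<beta>) (D2_dist \<beta>) (gen_hilbert g) \<longleftrightarrow>
    (\<lambda>N. \<Sum>n = 2 ^ N..2 ^ (N + 1) - 1. (cmod (b (n + 1)))\<^sup>2)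
      \<in> o(\<lambda>N. 2 powr (real N * (\<beta> - \<alpha> - 1)))"
proof -
  have b: "b = taylor_coeff g"
    using power_series_on_disc(2)[OF assms(2)] by auto
  \<comment> \<open>Positivity of M keeps the truncated subtraction on \<open>nat\<close>
    harmless.\<close>
  have "{m..M - 1} = {m..<M}" if "M > 0" for m M :: nat using that by auto
  hence eq: "(\<lambda>N. \<Sum>n = 2 ^ N..2 ^ (N + 1) - 1. (cmod (b (n + 1)))\<^sup>2) =
      (\<lambda>N. \<Sum>n=2 ^ N..<2 ^ Suc N. (cmod (taylor_coeff g (Suc n)))\<^sup>2)"
    by (simp add: b)
  have iff: "(S \<in> o(\<lambda>N. 2 powr (real N * p))) \<longleftrightarrow> (\<lambda>N. S N / 2 powr (real N * p)) \<longlonglongrightarrow> 0"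
    for S :: "nat \<Rightarrow> real" and p
    by (auto intro: smalloI_tendsto dest: smalloD_tendsto)
  show ?thesis
    unfolding eq iff
    using compact_gen_hilbert[OF assms(1,3,4)] compact_gen_hilbert_imp[OF assms(1,3,4)] by blast
qed

end
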